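(* Every infinite irreducible right-angled Coxeter group of (finite) rank more than two does not have the congruence subgroup property. In particular, for every $n\ge 4$ the twin group $T_n$ does not have the congruence subgroup property.
   Context: A right-angled Coxeter group $W$ of finite rank $r$ is given with a Coxeter system $S=\{w_1,\dots,w_r\}$ and presentation $\langle S\mid (w_iw_j)^{m_{i,j}}=1\rangle$, where $m_{i,j}=m_{j,i}$, $m_{i,i}=1$ and $m_{i,j}\in\{2,\infty\}$ for $i\ne j$ (no relation is imposed when $m_{i,j}=\infty$). It is irreducible if $S$ is not the disjoint union of two nonempty subsets such that every element of one commutes with every element of the other. The twin group is $T_n=\langle s_1,\dots,s_{n-1}\mid s_k^2=1 \text{ for all } k,\ s_is_j=s_js_i \text{ for } |i-j|\ge 2\rangle$, a right-angled Coxeter group with generating set $\{s_1,\dots,s_{n-1}\}$. Tits representation: let $V$ be the real vector space with basis $e_1,\dots,e_r$, and let $B$ be the symmetric bilinear form with $B(e_i,e_j)=-\cos(\pi/m_{i,j})$ if $m_{i,j}\neq\infty$ and $B(e_i,e_j)=-1$ if $m_{i,j}=\infty$. The Tits representation $\rho:W\to \mathrm{GL}(V)$ is given by $\rho(w_i)(v)=v-2B(e_i,v)e_i$. In the basis $e_1,\dots,e_r$ its matrices have integer entries, so $\rho:W\to \mathrm{GL}(r,\mathbb{Z})$. For $m\ge 2$, the principal congruence subgroup $W[m]$ is the kernel of the composition of $\rho$ with the reduction $\mathrm{GL}(r,\mathbb{Z})\to \mathrm{GL}(r,\mathbb{Z}/m\mathbb{Z})$. $W$ has the congruence subgroup property if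 every finite index subgroup of $W$ contains $W[m]$ for some $m\ge2$. *)

theory Defs
  imports
    Complex_Main
    "HOL-Library.Extended_Nat"
    "HOL-Library.FuncSet"
    "HOL-Number_Theory.Cong"
    "HOL-Algebra.Coset"
    "Jordan_Normal_Form.Matrix"
begin

section \<open>Group presentations\<close>

text \<open>A letter \<open>(x, True)\<close> is the generator \<open>x\<close>, a letter \<open>(x, False)\<close> its formal inverse.
  A defining relation is a pair \<open>(p, q)\<close> of words, read as \<open>p = q\<close>.\<close>

type_synonym 'x word = "('x \<times> bool) list"

definition words :: "'x set \<Rightarrow> 'x word set" where
  "words S = lists (S \<times> UNIV)"

inductive pres_eq :: "'x set \<Rightarrow> ('x word \<times> 'x word) set \<Rightarrow> 'x word \<Rightarrow> 'x word \<Rightarrow> bool"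
  for S R where
  pe_refl: "u \<in> words S \<Longrightarrow> pres_eq S R u u"
| pe_sym: "pres_eq S R u v \<Longrightarrow> pres_eq S R v u"
| pe_trans: "pres_eq S R u v \<Longrightarrow> pres_eq S R v w \<Longrightarrow> pres_eq S R u w"
| pe_cancel: "u \<in> words S \<Longrightarrow> v \<in> words S \<Longrightarrow> x \<in> S \<Longrightarrow>
    pres_eq S R (u @ [(x, b), (x, \<not> b)] @ v) (u @ v)"
| pe_rel: "u \<in> words S \<Longrightarrow> v \<in> words S \<Longrightarrow> (p, q) \<in> R \<Longrightarrow> p \<in> words S \<Longrightarrow> q \<in> words S \<Longrightarrow>
    pres_eq S R (u @ p @ v) (u @ q @ v)"

definition pres_class :: "'x set \<Rightarrow> ('x word \<times> 'x word) set \<Rightarrow> 'x word \<Rightarrow> 'x word set" where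
  "pres_class S R u = {v. pres_eq S R u v}"

definition presented_group :: "'x set \<Rightarrow> ('x word \<times> 'x word) set \<Rightarrow> 'x word set monoid" where
  "presented_group S R =
    \<lparr>carrier = pres_class S R ` words S,
     mult = (\<lambda>A B. \<Union>u\<in>A. \<Union>v\<in>B. pres_class S R (u @ v)),
     one = pres_class S R []\<rparr>"


section \<open>Coxeter systems\<close>

text \<open>Generators are indexed by \<open>0, \<dots>, r - 1\<close> instead of \<open>1, \<dots>, r\<close>; a matrix entry
  \<open>\<infinity>\<close> imposes no relation.\<close>

definition right_angled_matrix :: "nat \<Rightarrow> (nat \<Rightarrow> nat \<Rightarrow> enat) \<Rightarrow> bool" where
  "right_angled_matrix r m \<longleftrightarrow>
    (\<forall>i<r. m i i = 1) \<and>
    (\<forall>i<r. \<forall>j<r. m i j = m j i) \<and>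
    (\<forall>i<r. \<forall>j<r. i \<noteq> j \<longrightarrow> m i j \<in> {2, \<infinity>})"

definition coxeter_relations ::
    "nat \<Rightarrow> (nat \<Rightarrow> nat \<Rightarrow> enat) \<Rightarrow> (nat word \<times> nat word) set" where
  "coxeter_relations r m =
    {(concat (replicate k [(i, True), (j, True)]), []) | i j k. i < r \<and> j < r \<and> m i j = enat k}"

definition coxeter_group :: "nat \<Rightarrow> (nat \<Rightarrow> nat \<Rightarrow> enat) \<Rightarrow> nat word set monoid" where
  "coxeter_group r m = presented_group {..<r} (coxeter_relations r m)"

definition coxeter_gen :: "nat \<Rightarrow> (nat \<Rightarrow> nat \<Rightarrow> enat) \<Rightarrow> nat \<Rightarrow> nat word set" where
  "coxeter_gen r m i = pres_class {..<r} (coxeter_relations r m) [(i, True)]"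

text \<open>The group \<open>W\<close> with the family \<open>w 0, \<dots>, w (r - 1)\<close> has the presentation given by the
  right-angled Coxeter matrix \<open>m\<close>.\<close>

definition right_angled_coxeter_system ::
    "('a, 'b) monoid_scheme \<Rightarrow> nat \<Rightarrow> (nat \<Rightarrow> 'a) \<Rightarrow> (nat \<Rightarrow> nat \<Rightarrow> enat) \<Rightarrow> bool" where
  "right_angled_coxeter_system W r w m \<longleftrightarrow>
    group W \<and> right_angled_matrix r m \<and>
    (\<exists>\<phi> \<in> iso (coxeter_group r m) W. \<forall>i<r. \<phi> (coxeter_gen r m i) = w i)"

definition irreducible_system :: "('a, 'b) monoid_scheme \<Rightarrow> 'a set \<Rightarrow> bool" where
  "irreducible_system W S \<longleftrightarrow>
    \<not> (\<exists>A B. A \<noteq> {} \<and> B \<noteq> {} \<and> A \<inter> B = {} \<and> A \<union> B = S \<and>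
         (\<forall>a\<in>A. \<forall>b\<in>B. a \<otimes>\<^bsub>W\<^esub> b = b \<otimes>\<^bsub>W\<^esub> a))"


section \<open>The Tits representation and congruence subgroups\<close>

text \<open>\<open>V\<close> is \<open>carrier_vec r\<close> over the reals, with basis \<open>e\<^sub>i = unit_vec r i\<close>.\<close>

definition tits_coeff :: "(nat \<Rightarrow> nat \<Rightarrow> enat) \<Rightarrow> nat \<Rightarrow> nat \<Rightarrow> real" where
  "tits_coeff m i j = (case m i j of enat k \<Rightarrow> - cos (pi / real k) | \<infinity> \<Rightarrow> -1)"

definition tits_form :: "nat \<Rightarrow> (nat \<Rightarrow> nat \<Rightarrow> enat) \<Rightarrow> real vec \<Rightarrow> real vec \<Rightarrow> real" where
  "tits_form r m u v = (\<Sum>i<r. \<Sum>j<r. u $ i * v $ j * tits_coeff m i j)"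

definition tits_reflection :: "nat \<Rightarrow> (nat \<Rightarrow> nat \<Rightarrow> enat) \<Rightarrow> nat \<Rightarrow> real vec \<Rightarrow> real vec" where
  "tits_reflection r m i v = v - (2 * tits_form r m (unit_vec r i) v) \<cdot>\<^sub>v unit_vec r i"

definition tits_matrix :: "nat \<Rightarrow> (nat \<Rightarrow> nat \<Rightarrow> enat) \<Rightarrow> nat \<Rightarrow> real mat" where
  "tits_matrix r m i = mat_of_cols r (map (\<lambda>j. tits_reflection r m i (unit_vec r j)) [0..<r])"

definition GL :: "nat \<Rightarrow> real mat monoid" where
  "GL r = units_of (ring_mat TYPE(real) r ())"

text \<open>The homomorphism is determined by its values on the generators; \<open>extensional\<close> fixes
  the irrelevant values outside \<open>carrier W\<close>.\<close>

definition tits_rep ::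
    "('a, 'b) monoid_scheme \<Rightarrow> nat \<Rightarrow> (nat \<Rightarrow> 'a) \<Rightarrow> (nat \<Rightarrow> nat \<Rightarrow> enat) \<Rightarrow> 'a \<Rightarrow> real mat" where
  "tits_rep W r w m =
    (THE \<rho>. \<rho> \<in> hom W (GL r) \<inter> extensional (carrier W) \<and> (\<forall>i<r. \<rho> (w i) = tits_matrix r m i))"

text \<open>The integer matrix \<open>A\<close> is the matrix of \<open>\<rho> g\<close>, and the congruences say that its reduction
  is the identity of \<open>GL(r, \<int>/k)\<close>.\<close>

definition principal_congruence_subgroup ::
    "('a, 'b) monoid_scheme \<Rightarrow> nat \<Rightarrow> (nat \<Rightarrow> 'a) \<Rightarrow> (nat \<Rightarrow> nat \<Rightarrow> enat) \<Rightarrow> nat \<Rightarrow> 'a set" where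
  "principal_congruence_subgroup W r w m k =
    {g \<in> carrier W. \<exists>A \<in> carrier_mat r r. tits_rep W r w m g = map_mat real_of_int A \<and>
       (\<forall>i<r. \<forall>j<r. [A $$ (i, j) = 1\<^sub>m r $$ (i, j)] (mod int k))}"

definition has_congruence_subgroup_property ::
    "('a, 'b) monoid_scheme \<Rightarrow> nat \<Rightarrow> (nat \<Rightarrow> 'a) \<Rightarrow> (nat \<Rightarrow> nat \<Rightarrow> enat) \<Rightarrow> bool" where
  "has_congruence_subgroup_property W r w m \<longleftrightarrow>
    (\<forall>H. subgroup H W \<and> finite (rcosets\<^bsub>W\<^esub> H) \<longrightarrow>
       (\<exists>k\<ge>2. principal_congruence_subgroup W r w m k \<subseteq> H))"


section \<open>Twin groups\<close>

text \<open>The generators \<open>s\<^sub>1, \<dots>, s\<^sub>n\<^sub>-\<^sub>1\<close> are indexed by \<open>0, \<dots>, n - 2\<close>, which leaves \<open>\<bar>i - j\<bar>\<close> unchanged.\<close>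

definition twin_relations :: "nat \<Rightarrow> (nat word \<times> nat word) set" where
  "twin_relations n =
    {([(k, True), (k, True)], []) | k. k < n - 1} \<union>
    {([(i, True), (j, True)], [(j, True), (i, True)]) | i j.
       i < n - 1 \<and> j < n - 1 \<and> \<bar>int i - int j\<bar> \<ge> 2}"

definition twin_group :: "nat \<Rightarrow> nat word set monoid" where
  "twin_group n = presented_group {..<n - 1} (twin_relations n)"

definition twin_gen :: "nat \<Rightarrow> nat \<Rightarrow> nat word set" where
  "twin_gen n i = pres_class {..<n - 1} (twin_relations n) [(i, True)]"

definition twin_matrix :: "nat \<Rightarrow> nat \<Rightarrow> enat" where
  "twin_matrix i j = (if i = j then 1 else if \<bar>int i - int j\<bar> \<ge> 2 then 2 else \<infinity>)"

section \<open>Well-definedness\<close>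

lemma words_append [simp]: "u @ v \<in> words S \<longleftrightarrow> u \<in> words S \<and> v \<in> words S"
  by (simp add: words_def)

lemma words_Nil [simp]: "[] \<in> words S"
  by (simp add: words_def)

lemma words_Cons [simp]: "p # v \<in> words S \<longleftrightarrow> fst p \<in> S \<and> v \<in> words S"
  by (cases p) (auto simp: words_def)

lemma pres_eq_words: "pres_eq S R u v \<Longrightarrow> u \<in> words S \<and> v \<in> words S"
  by (induction rule: pres_eq.induct) auto

lemma pres_eq_context:
  assumes "pres_eq S R u v" and ab: "a \<in> words S" "b \<in> words S"
  shows "pres_eq S R (a @ u @ b) (a @ v @ b)"
  using assms(1)
proof (induction rule: pres_eq.induct)
  case (pe_cancel u v x c)
  then show ?case using pres_eq.pe_cancel[of "a @ u" S "v @ b" x R c] ab by simp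
next
  case (pe_rel u v p q)
  then show ?case using pres_eq.pe_rel[of "a @ u" S "v @ b" p q R] ab by simp
next
  case (pe_refl u)
  then show ?case using ab by (intro pres_eq.pe_refl) simp
qed (blast intro: pres_eq.pe_sym pres_eq.pe_trans)+

lemma pres_eq_append:
  assumes "pres_eq S R u u'" "pres_eq S R v v'"
  shows "pres_eq S R (u @ v) (u' @ v')"
  using pres_eq_context[OF assms(1), of "[]" v] pres_eq_context[OF assms(2), of u' "[]"]
    pres_eq_words[OF assms(1)] pres_eq_words[OF assms(2)]
  by (auto intro: pres_eq.pe_trans)

lemma pres_eq_mono:
  assumes "pres_eq S R u v" and R: "\<And>p q. (p, q) \<in> R \<Longrightarrow> pres_eq S R' p q"
  shows "pres_eq S R' u v"
  using assms(1)
proof (induction rule: pres_eq.induct)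
  case (pe_rel u v p q)
  then show ?case using R pres_eq_context by blast
next
  case (pe_cancel u v x b)
  then show ?case by (rule pres_eq.pe_cancel)
next
  case (pe_sym u v)
  show ?case using pe_sym.IH by (rule pres_eq.pe_sym)
next
  case (pe_trans u v w)
  show ?case using pe_trans.IH by (rule pres_eq.pe_trans)
qed (rule pres_eq.pe_refl)

lemma pres_class_eq:
  "u \<in> words S \<Longrightarrow> pres_class S R u = pres_class S R v \<longleftrightarrow> pres_eq S R u v"
  unfolding pres_class_def by (auto intro: pres_eq.intros)

lemma pres_class_mult:
  assumes "u \<in> words S" "v \<in> words S"
  shows "pres_class S R u \<otimes>\<^bsub>presented_group S R\<^esub> pres_class S R v = pres_class S R (u @ v)"
proof -
  have "pres_class S R (u' @ v') = pres_class S R (u @ v)"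
    if "u' \<in> pres_class S R u" "v' \<in> pres_class S R v" for u' v'
  proof -
    have "pres_eq S R (u @ v) (u' @ v')"
      using that by (intro pres_eq_append) (auto simp: pres_class_def)
    moreover have "u @ v \<in> words S" using assms by simp
    ultimately show ?thesis by (metis pres_class_eq)
  qed
  moreover have "u \<in> pres_class S R u" "v \<in> pres_class S R v"
    using assms by (auto simp: pres_class_def intro: pres_eq.pe_refl)
  ultimately have "(\<Union>u'\<in>pres_class S R u. \<Union>v'\<in>pres_class S R v. pres_class S R (u' @ v'))
      = pres_class S R (u @ v)" by blast
  then show ?thesis by (simp add: presented_group_def)
qed

lemma pres_eq_inverse:
  "u \<in> words S \<Longrightarrow> pres_eq S R (rev (map (\<lambda>(x, b). (x, \<not> b)) u) @ u) []"
proof (induction u)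
  case Nil
  show ?case by (auto intro: pres_eq.pe_refl)
next
  case (Cons p u)
  obtain x b where p: "p = (x, b)" by fastforce
  let ?w = "rev (map (\<lambda>(x, b). (x, \<not> b)) u)"
  have "?w \<in> words S" using Cons.prems by (auto simp: words_def)
  then have "pres_eq S R (?w @ [(x, \<not> b), (x, \<not> \<not> b)] @ u) (?w @ u)"
    using Cons.prems p by (intro pres_eq.pe_cancel) auto
  then show ?case using Cons p by (auto intro: pres_eq.pe_trans)
qed

lemma group_presented_group: "group (presented_group S R)"
proof (rule groupI)
  show "\<one>\<^bsub>presented_group S R\<^esub> \<in> carrier (presented_group S R)"
    by (simp add: presented_group_def)
next
  fix x assume "x \<in> carrier (presented_group S R)"
  then obtain u where u: "u \<in> words S" "x = pres_class S R u"
    by (auto simp: presented_group_def)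
  have one: "\<one>\<^bsub>presented_group S R\<^esub> = pres_class S R []"
    by (simp add: presented_group_def)
  show "\<one>\<^bsub>presented_group S R\<^esub> \<otimes>\<^bsub>presented_group S R\<^esub> x = x"
    using u by (simp add: one pres_class_mult)
  let ?w = "rev (map (\<lambda>(x, b). (x, \<not> b)) u)"
  have "?w \<in> words S" using u by (auto simp: words_def)
  then have "pres_class S R ?w \<in> carrier (presented_group S R)"
    by (simp add: presented_group_def)
  moreover have "pres_class S R ?w \<otimes>\<^bsub>presented_group S R\<^esub> x = \<one>\<^bsub>presented_group S R\<^esub>"
    unfolding one u(2) pres_class_mult[OF \<open>?w \<in> words S\<close> u(1)]
    using u \<open>?w \<in> words S\<close> pres_eq_inverse[of u S R] by (simp add: pres_class_eq)
  ultimately show "\<exists>y\<in>carrier (presented_group S R).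
      y \<otimes>\<^bsub>presented_group S R\<^esub> x = \<one>\<^bsub>presented_group S R\<^esub>" by blast
next
  fix x y assume "x \<in> carrier (presented_group S R)" "y \<in> carrier (presented_group S R)"
  then obtain u v where u: "u \<in> words S" "x = pres_class S R u"
    and v: "v \<in> words S" "y = pres_class S R v"
    by (auto simp: presented_group_def)
  show "x \<otimes>\<^bsub>presented_group S R\<^esub> y \<in> carrier (presented_group S R)"
    unfolding u(2) v(2) pres_class_mult[OF u(1) v(1)]
    using u v by (simp add: presented_group_def)
  fix z assume "z \<in> carrier (presented_group S R)"
  then obtain w where w: "w \<in> words S" "z = pres_class S R w"
    by (auto simp: presented_group_def)
  show "x \<otimes>\<^bsub>presented_group S R\<^esub> y \<otimes>\<^bsub>presented_group S R\<^esub> z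
      = x \<otimes>\<^bsub>presented_group S R\<^esub> (y \<otimes>\<^bsub>presented_group S R\<^esub> z)"
    using u v w by (simp add: pres_class_mult)
qed

lemma twin_relation_coxeter:
  assumes "(p, q) \<in> twin_relations n"
  shows "pres_eq {..<n - 1} (coxeter_relations (n - 1) twin_matrix) p q"
proof -
  let ?S = "{..<n - 1}" and ?R = "coxeter_relations (n - 1) twin_matrix"
  let ?E = "pres_eq ?S ?R"
  have sq: "?E [(k, True), (k, True)] []" if "k < n - 1" for k
  proof -
    have "(concat (replicate 1 [(k, True), (k, True)]), []) \<in> ?R"
      using that unfolding coxeter_relations_def
      by (intro CollectI exI[of _ k] exI[of _ 1]) (auto simp: twin_matrix_def one_enat_def)
    then show ?thesis using that pres_eq.pe_rel[of "[]" ?S "[]" _ _ ?R] by auto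
  qed
  consider k where "k < n - 1" "p = [(k, True), (k, True)]" "q = []"
    | i j where "i < n - 1" "j < n - 1" "\<bar>int i - int j\<bar> \<ge> 2"
      "p = [(i, True), (j, True)]" "q = [(j, True), (i, True)]"
    using assms by (auto simp: twin_relations_def)
  then show ?thesis
  proof cases
    case 1
    then show ?thesis using sq by simp
  next
    case (2 i j)
    let ?i = "(i, True)" and ?j = "(j, True)"
    have "(concat (replicate 2 [?i, ?j]), []) \<in> ?R"
      using 2 unfolding coxeter_relations_def
      by (intro CollectI exI[of _ i] exI[of _ j] exI[of _ 2])
         (auto simp: twin_matrix_def numeral_eq_enat)
    then have ijij: "?E [?i, ?j, ?i, ?j] []"
      using 2 pres_eq.pe_rel[of "[]" ?S "[]" _ _ ?R] by (auto simp: numeral_2_eq_2)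
    have "?E [?i, ?j, ?i, ?j, ?j, ?i] [?j, ?i]"
      using pres_eq_context[OF ijij, of "[]" "[?j, ?i]"] 2 by simp
    moreover have "?E [?i, ?j, ?i, ?j, ?j, ?i] [?i, ?j, ?i, ?i]"
      using pres_eq_context[OF sq[of j], of "[?i, ?j, ?i]" "[?i]"] 2 by simp
    moreover have "?E [?i, ?j, ?i, ?i] [?i, ?j]"
      using pres_eq_context[OF sq[of i], of "[?i, ?j]" "[]"] 2 by simp
    ultimately show ?thesis using 2 by (blast intro: pres_eq.pe_sym pres_eq.pe_trans)
  qed
qed

lemma coxeter_relation_twin:
  assumes "(p, q) \<in> coxeter_relations (n - 1) twin_matrix"
  shows "pres_eq {..<n - 1} (twin_relations n) p q"
proof -
  let ?S = "{..<n - 1}" and ?R = "twin_relations n"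
  let ?E = "pres_eq ?S ?R"
  have sq: "?E [(k, True), (k, True)] []" if "k < n - 1" for k
  proof -
    have "([(k, True), (k, True)], []) \<in> ?R"
      using that by (auto simp: twin_relations_def)
    then show ?thesis using that pres_eq.pe_rel[of "[]" ?S "[]" _ _ ?R] by auto
  qed
  obtain i j k where ij: "i < n - 1" "j < n - 1" "twin_matrix i j = enat k"
    "p = concat (replicate k [(i, True), (j, True)])" "q = []"
    using assms by (auto simp: coxeter_relations_def)
  let ?i = "(i, True)" and ?j = "(j, True)"
  show ?thesis
  proof (cases "i = j")
    case True
    then have "k = 1" using ij by (auto simp: twin_matrix_def one_enat_def)
    then show ?thesis using ij True sq by simp
  next
    case False
    then have k: "k = 2" "\<bar>int i - int j\<bar> \<ge> 2"
      using ij by (auto simp: twin_matrix_def numeral_eq_enat split: if_splits)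
    have "([?i, ?j], [?j, ?i]) \<in> ?R"
      using ij k by (auto simp: twin_relations_def)
    then have "?E ([] @ [?i, ?j] @ [?i, ?j]) ([] @ [?j, ?i] @ [?i, ?j])"
      using ij by (intro pres_eq.pe_rel) auto
    moreover have "?E [?j, ?i, ?i, ?j] [?j, ?j]"
      using pres_eq_context[OF sq[of i], of "[?j]" "[?j]"] ij by simp
    ultimately have "?E [?i, ?j, ?i, ?j] []"
      using sq[of j] ij by (auto intro: pres_eq.pe_trans)
    then show ?thesis using ij k by (simp add: numeral_2_eq_2)
  qed
qed

lemma twin_class_eq:
  "pres_class {..<n - 1} (twin_relations n) =
   pres_class {..<n - 1} (coxeter_relations (n - 1) twin_matrix)"
  unfolding pres_class_def
  by (intro ext Collect_cong iffI)
     (erule pres_eq_mono, erule twin_relation_coxeter coxeter_relation_twin)+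

theorem twin_group_coxeter_system:
  "right_angled_coxeter_system (twin_group n) (n - 1) (twin_gen n) twin_matrix"
proof -
  have eq: "twin_group n = coxeter_group (n - 1) twin_matrix"
    by (simp only: twin_group_def coxeter_group_def presented_group_def twin_class_eq)
  have "twin_gen n = coxeter_gen (n - 1) twin_matrix"
    by (intro ext) (simp only: twin_gen_def coxeter_gen_def twin_class_eq)
  moreover have "right_angled_matrix (n - 1) twin_matrix"
    by (auto simp: right_angled_matrix_def twin_matrix_def)
  moreover have "(\<lambda>x. x) \<in> iso (coxeter_group (n - 1) twin_matrix) (coxeter_group (n - 1) twin_matrix)"
    by (rule iso_set_refl)
  moreover have "group (coxeter_group (n - 1) twin_matrix)"
    unfolding coxeter_group_def by (rule group_presented_group)
  ultimately show ?thesis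
    unfolding right_angled_coxeter_system_def eq by auto
qed

lemma tits_matrix_carrier [simp]: "tits_matrix r m i \<in> carrier_mat r r"
  unfolding tits_matrix_def by (rule carrier_matI) simp_all

lemma tits_form_unit_vec:
  assumes "i < r" "b < r"
  shows "tits_form r m (unit_vec r i) (unit_vec r b) = tits_coeff m i b"
proof -
  have "unit_vec r i $ k * unit_vec r b $ l * tits_coeff m k l =
      (if l = b then if k = i then tits_coeff m i b else 0 else 0)" if "k < r" "l < r" for k l
    using that assms by (cases "k = i"; cases "l = b"; simp)
  then have "tits_form r m (unit_vec r i) (unit_vec r b) =
      (\<Sum>k<r. \<Sum>l<r. if l = b then if k = i then tits_coeff m i b else 0 else 0)"
    unfolding tits_form_def by (intro sum.cong refl) (simp only: lessThan_iff)
  also have "\<dots> = (\<Sum>k<r. if k = i then tits_coeff m i b else 0)"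
    using assms(2) by (simp only: sum.delta finite_lessThan lessThan_iff if_True)
  also have "\<dots> = tits_coeff m i b"
    using assms(1) by (simp only: sum.delta finite_lessThan lessThan_iff if_True)
  finally show ?thesis .
qed

lemma tits_matrix_index:
  assumes "i < r" "a < r" "b < r"
  shows "tits_matrix r m i $$ (a, b) =
    (if a = b then 1 else 0) - (if a = i then 2 * tits_coeff m i b else 0)"
proof -
  have "tits_matrix r m i $$ (a, b) = tits_reflection r m i (unit_vec r b) $ a"
    unfolding tits_matrix_def using assms by (subst mat_of_cols_index) simp_all
  also have "\<dots> = unit_vec r b $ a - 2 * tits_coeff m i b * unit_vec r i $ a"
    unfolding tits_reflection_def tits_form_unit_vec[OF assms(1,3)] using assms(2) by simp
  finally show ?thesis using assms by (simp add: unit_vec_def)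
qed

lemma tits_matrix_mult_index:
  assumes "i < r" "j < r" "a < r" "b < r"
  shows "(tits_matrix r m i * tits_matrix r m j) $$ (a, b) =
    (if a = b then 1 else 0) - (if a = j then 2 * tits_coeff m j b else 0)
    - (if a = i then 2 * tits_coeff m i b - 4 * tits_coeff m i j * tits_coeff m j b else 0)"
proof -
  have "(tits_matrix r m i * tits_matrix r m j) $$ (a, b) =
    (\<Sum>k<r. tits_matrix r m i $$ (a, k) * tits_matrix r m j $$ (k, b))"
  proof -
    have d: "dim_row (tits_matrix r m i) = r" "dim_col (tits_matrix r m i) = r"
      "dim_row (tits_matrix r m j) = r" "dim_col (tits_matrix r m j) = r"
      by (rule carrier_matD tits_matrix_carrier)+
    have "(tits_matrix r m i * tits_matrix r m j) $$ (a, b)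
        = row (tits_matrix r m i) a \<bullet> col (tits_matrix r m j) b"
      using assms d by (intro index_mult_mat(1)) simp_all
    also have "\<dots> = (\<Sum>k<r. row (tits_matrix r m i) a $ k * col (tits_matrix r m j) b $ k)"
      by (simp only: scalar_prod_def dim_col d atLeast0LessThan)
    also have "\<dots> = (\<Sum>k<r. tits_matrix r m i $$ (a, k) * tits_matrix r m j $$ (k, b))"
      using assms d by (intro sum.cong refl) simp
    finally show ?thesis .
  qed
  also have "\<dots> = (\<Sum>k<r. (if k = a then tits_matrix r m j $$ (k, b) else 0)
    - (if k = b then (if a = i then 2 * tits_coeff m i k else 0) else 0)
    + (if k = j then (if a = i then 4 * tits_coeff m i k * tits_coeff m j b else 0) else 0))"
  proof (intro sum.cong refl, goal_cases)
    case (1 k)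
    then have k: "k < r" by simp
    show ?case
      unfolding tits_matrix_index[OF assms(1,3) k] tits_matrix_index[OF assms(2) k assms(4)]
      by (simp add: eq_commute[of a k] split del: if_split) (auto simp: algebra_simps)
  qed
  also have "\<dots> = tits_matrix r m j $$ (a, b) - (if a = i then 2 * tits_coeff m i b else 0)
    + (if a = i then 4 * tits_coeff m i j * tits_coeff m j b else 0)"
    using assms(2-4)
    by (simp only: sum.distrib sum_subtractf sum.delta finite_lessThan lessThan_iff if_True)
  also have "\<dots> = (if a = b then 1 else 0) - (if a = j then 2 * tits_coeff m j b else 0)
    - (if a = i then 2 * tits_coeff m i b - 4 * tits_coeff m i j * tits_coeff m j b else 0)"
    unfolding tits_matrix_index[OF assms(2-4)] by (cases "a = i") simp_all
  finally show ?thesis .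
qed

lemma tits_coeff_simps:
  "m i j = 1 \<Longrightarrow> tits_coeff m i j = 1"
  "m i j = 2 \<Longrightarrow> tits_coeff m i j = 0"
  unfolding tits_coeff_def one_enat_def numeral_eq_enat by (simp_all only: enat.case) simp_all

lemma enat_eq_12:
  "(1 :: enat) = enat k \<longleftrightarrow> k = 1"
  "(2 :: enat) = enat k \<longleftrightarrow> k = 2"
  unfolding one_enat_def numeral_eq_enat enat.inject by auto

lemma tits_matrix_square:
  assumes "right_angled_matrix r m" "i < r"
  shows "tits_matrix r m i * tits_matrix r m i = 1\<^sub>m r"
proof (rule eq_matI)
  have "tits_coeff m i i = 1"
    using assms by (simp add: right_angled_matrix_def tits_coeff_simps)
  then show "(tits_matrix r m i * tits_matrix r m i) $$ (a, b) = 1\<^sub>m r $$ (a, b)"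
    if "a < dim_row (1\<^sub>m r :: real mat)" "b < dim_col (1\<^sub>m r :: real mat)" for a b
    using that assms by (simp add: tits_matrix_mult_index)
qed (simp_all add: tits_matrix_def)

lemma tits_matrix_commute:
  assumes "right_angled_matrix r m" "i < r" "j < r" "m i j = 2"
  shows "tits_matrix r m i * tits_matrix r m j = tits_matrix r m j * tits_matrix r m i"
proof (rule eq_matI)
  have "m j i = 2" using assms by (simp add: right_angled_matrix_def)
  then have "tits_coeff m i j = 0" "tits_coeff m j i = 0"
    using assms by (simp_all add: tits_coeff_simps)
  then show "(tits_matrix r m i * tits_matrix r m j) $$ (a, b)
      = (tits_matrix r m j * tits_matrix r m i) $$ (a, b)"
    if "a < dim_row (tits_matrix r m j * tits_matrix r m i)"
      "b < dim_col (tits_matrix r m j * tits_matrix r m i)" for a b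
    using that assms tits_matrix_carrier[of r m i] tits_matrix_carrier[of r m j]
    by (auto simp: tits_matrix_mult_index)
qed (simp_all add: tits_matrix_def)

definition tits_word :: "nat \<Rightarrow> (nat \<Rightarrow> nat \<Rightarrow> enat) \<Rightarrow> nat word \<Rightarrow> real mat" where
  "tits_word r m u = foldr (\<lambda>p M. tits_matrix r m (fst p) * M) u (1\<^sub>m r)"

lemma tits_word_simps [simp]:
  "tits_word r m [] = 1\<^sub>m r"
  "tits_word r m (p # u) = tits_matrix r m (fst p) * tits_word r m u"
  by (simp_all add: tits_word_def)

lemma tits_word_carrier [simp]: "tits_word r m u \<in> carrier_mat r r"
  by (induction u) (auto intro!: mult_carrier_mat)

lemma tits_word_append: "tits_word r m (u @ v) = tits_word r m u * tits_word r m v"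
proof (induction u)
  case Nil
  show ?case using left_mult_one_mat[OF tits_word_carrier[of r m v]] by simp
next
  case (Cons p u)
  then show ?case
    using assoc_mult_mat[OF tits_matrix_carrier[of r m "fst p"] tits_word_carrier[of r m u]
        tits_word_carrier[of r m v]] by simp
qed

lemma tits_word_cong:
  assumes ra: "right_angled_matrix r m"
    and "pres_eq {..<r} (coxeter_relations r m) u v"
  shows "tits_word r m u = tits_word r m v"
  using assms(2)
proof (induction rule: pres_eq.induct)
  case (pe_cancel u v x b)
  have "tits_word r m [(x, b), (x, \<not> b)] = 1\<^sub>m r"
    using ra pe_cancel right_mult_one_mat[OF tits_matrix_carrier[of r m x]]
    by (simp add: tits_matrix_square)
  then show ?case
    unfolding tits_word_append using left_mult_one_mat[OF tits_word_carrier[of r m v]] by simp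
next
  case (pe_rel u v p q)
  obtain i j k where ij: "i < r" "j < r" "m i j = enat k"
    "p = concat (replicate k [(i, True), (j, True)])" "q = []"
    using pe_rel by (auto simp: coxeter_relations_def)
  let ?A = "tits_matrix r m i" and ?B = "tits_matrix r m j"
  note c = tits_matrix_carrier[of r m i] tits_matrix_carrier[of r m j]
  have "tits_word r m p = 1\<^sub>m r"
  proof (cases "i = j")
    case True
    then have "k = 1" using ij ra by (simp add: right_angled_matrix_def enat_eq_12)
    then show ?thesis using ij True ra right_mult_one_mat[OF c(1)]
      by (simp add: tits_matrix_square)
  next
    case False
    then have "m i j \<in> {2, \<infinity>}" using ij(1,2) ra unfolding right_angled_matrix_def by blast
    then have "m i j = 2" using ij(3) by auto
    then have "k = 2" using ij(3) enat_eq_12(2) by metis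
    have "tits_word r m p = ?A * (?B * (?A * ?B))"
      using ij(4) \<open>k = 2\<close> right_mult_one_mat[OF c(2)] by (simp add: numeral_2_eq_2)
    also have "\<dots> = ?A * (?B * (?B * ?A))"
      by (simp only: tits_matrix_commute[OF ra ij(1,2) \<open>m i j = 2\<close>])
    also have "\<dots> = ?A * ((?B * ?B) * ?A)"
      by (simp only: assoc_mult_mat[OF c(2) c(2) c(1)])
    also have "\<dots> = 1\<^sub>m r"
      by (simp only: tits_matrix_square[OF ra] ij(1,2) left_mult_one_mat[OF c(1)])
    finally show ?thesis .
  qed
  then show ?case
    unfolding tits_word_append ij(5)
    using left_mult_one_mat[OF tits_word_carrier[of r m v]] by simp
qed auto

lemma tits_word_GL:
  assumes ra: "right_angled_matrix r m" and "u \<in> words {..<r}"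
  shows "tits_word r m u \<in> carrier (GL r)"
proof -
  interpret ring "ring_mat TYPE(real) r ()" by (rule ring_mat)
  have "tits_matrix r m i \<in> Units (ring_mat TYPE(real) r ())" if "i < r" for i
    using tits_matrix_square[OF ra that] tits_matrix_carrier[of r m i]
    unfolding Units_def by (auto simp: ring_mat_simps)
  then have "tits_word r m u \<in> Units (ring_mat TYPE(real) r ())"
    using assms(2)
  proof (induction u)
    case Nil
    show ?case using Units_one_closed by (simp add: ring_mat_simps)
  next
    case (Cons p u)
    then show ?case using Units_m_closed[of "tits_matrix r m (fst p)" "tits_word r m u"]
      by (simp add: ring_mat_simps)
  qed
  then show ?thesis by (simp add: GL_def units_of_def)
qed

theorem tits_rep_well_defined:
  assumes "right_angled_coxeter_system W r w m"
  shows "\<exists>!\<rho>. \<rho> \<in> hom W (GL r) \<inter> extensional (carrier W) \<and>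
    (\<forall>i<r. \<rho> (w i) = tits_matrix r m i)"
proof -
  let ?R = "coxeter_relations r m"
  let ?P = "presented_group {..<r} ?R"
  let ?cl = "pres_class {..<r} ?R"
  interpret W: group W using assms by (simp add: right_angled_coxeter_system_def)
  have ra: "right_angled_matrix r m"
    using assms by (simp add: right_angled_coxeter_system_def)
  obtain \<phi> where \<phi>: "\<phi> \<in> iso ?P W" and \<phi>w: "\<And>i. i < r \<Longrightarrow> \<phi> (?cl [(i, True)]) = w i"
    using assms by (auto simp: right_angled_coxeter_system_def coxeter_group_def coxeter_gen_def)
  define f where "f u = \<phi> (?cl u)" for u
  have carP: "carrier ?P = ?cl ` words {..<r}" by (simp add: presented_group_def)
  have bij: "bij_betw \<phi> (carrier ?P) (carrier W)" and hom: "\<phi> \<in> hom ?P W"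
    using \<phi> by (auto simp: iso_def)
  have fW: "f u \<in> carrier W" if "u \<in> words {..<r}" for u
    using that hom carP unfolding f_def by (auto simp: hom_def)
  have surj: "\<exists>u\<in>words {..<r}. f u = g" if "g \<in> carrier W" for g
  proof -
    have "g \<in> \<phi> ` ?cl ` words {..<r}"
      using that bij_betw_imp_surj_on[OF bij] carP by simp
    then show ?thesis unfolding f_def by auto
  qed
  have f_app: "f (u @ v) = f u \<otimes>\<^bsub>W\<^esub> f v" if "u \<in> words {..<r}" "v \<in> words {..<r}" for u v
  proof -
    have "f (u @ v) = \<phi> (?cl u \<otimes>\<^bsub>?P\<^esub> ?cl v)"
      unfolding f_def by (simp only: pres_class_mult[OF that])
    also have "\<dots> = f u \<otimes>\<^bsub>W\<^esub> f v"
      unfolding f_def using that carP by (intro hom_mult[OF hom]) auto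
    finally show ?thesis .
  qed
  have f_eq: "pres_eq {..<r} ?R u v" if "u \<in> words {..<r}" "v \<in> words {..<r}" "f u = f v" for u v
  proof -
    have "?cl u \<in> carrier ?P" "?cl v \<in> carrier ?P" using that carP by auto
    then have "?cl u = ?cl v"
      using inj_onD[OF bij_betw_imp_inj_on[OF bij] that(3)[unfolded f_def]] by blast
    then show ?thesis using pres_class_eq[OF that(1)] by blast
  qed
  have f_cong: "f u = f v" if "u \<in> words {..<r}" "pres_eq {..<r} ?R u v" for u v
    using pres_class_eq[OF that(1), of ?R v] that(2) unfolding f_def by simp
  have sq: "pres_eq {..<r} ?R [(i, True), (i, True)] []" if "i < r" for i
  proof -
    have "(concat (replicate 1 [(i, True), (i, True)]), []) \<in> ?R"
      using that ra unfolding coxeter_relations_def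
      by (intro CollectI exI[of _ i] exI[of _ 1]) (auto simp: right_angled_matrix_def enat_eq_12)
    then show ?thesis using that pres_eq.pe_rel[of "[]" "{..<r}" "[]" _ _ ?R] by auto
  qed
  have f_letter: "f [(i, b)] = w i" if "i < r" for i b
  proof (cases b)
    case True
    then show ?thesis using \<phi>w that by (simp add: f_def)
  next
    case False
    have "pres_eq {..<r} ?R [(i, False), (i, True), (i, True)] [(i, False)]"
      using pres_eq_context[OF sq[OF that], of "[(i, False)]" "[]"] that by simp
    moreover have "pres_eq {..<r} ?R [(i, False), (i, True), (i, True)] [(i, True)]"
      using pres_eq.pe_cancel[of "[]" "{..<r}" "[(i, True)]" i ?R False] that by simp
    ultimately have "pres_eq {..<r} ?R [(i, False)] [(i, True)]"
      by (blast intro: pres_eq.pe_sym pres_eq.pe_trans)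
    then show ?thesis using f_cong that False \<phi>w[of i] by (simp add: f_def)
  qed
  have GL: "mult (GL r) = (*)" "one (GL r) = 1\<^sub>m r"
    by (simp_all add: GL_def units_of_def ring_mat_simps)
  define \<rho> where "\<rho> = restrict (\<lambda>g. tits_word r m (SOME u. u \<in> words {..<r} \<and> f u = g)) (carrier W)"
  have \<rho>f: "\<rho> (f u) = tits_word r m u" if "u \<in> words {..<r}" for u
  proof -
    let ?v = "SOME v. v \<in> words {..<r} \<and> f v = f u"
    have "?v \<in> words {..<r} \<and> f ?v = f u" by (rule someI[of _ u]) (simp add: that)
    then have "tits_word r m ?v = tits_word r m u"
      using tits_word_cong[OF ra f_eq[of ?v u]] that by simp
    then show ?thesis using fW[OF that] by (simp add: \<rho>_def)
  qed
  show ?thesis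
  proof (rule ex1I)
    have "\<rho> \<in> hom W (GL r)"
    proof (rule homI)
      fix g assume "g \<in> carrier W"
      then show "\<rho> g \<in> carrier (GL r)" using surj \<rho>f tits_word_GL[OF ra] by metis
    next
      fix g h assume "g \<in> carrier W" "h \<in> carrier W"
      then obtain u v where u: "u \<in> words {..<r}" "f u = g" and v: "v \<in> words {..<r}" "f v = h"
        using surj by metis
      have "\<rho> (f (u @ v)) = \<rho> (f u) * \<rho> (f v)"
        using u(1) v(1) by (simp add: \<rho>f tits_word_append)
      then show "\<rho> (g \<otimes>\<^bsub>W\<^esub> h) = \<rho> g \<otimes>\<^bsub>GL r\<^esub> \<rho> h"
        unfolding f_app[OF u(1) v(1)] u(2) v(2) GL .
    qed
    moreover have "\<rho> (w i) = tits_matrix r m i" if "i < r" for i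
      using \<rho>f[of "[(i, True)]"] f_letter[OF that] that
        right_mult_one_mat[OF tits_matrix_carrier[of r m i]] by simp
    ultimately show "\<rho> \<in> hom W (GL r) \<inter> extensional (carrier W) \<and>
        (\<forall>i<r. \<rho> (w i) = tits_matrix r m i)"
      by (simp add: \<rho>_def)
  next
    fix \<sigma> assume \<sigma>: "\<sigma> \<in> hom W (GL r) \<inter> extensional (carrier W) \<and>
        (\<forall>i<r. \<sigma> (w i) = tits_matrix r m i)"
    interpret M: ring "ring_mat TYPE(real) r ()" by (rule ring_mat)
    interpret G: group "GL r" unfolding GL_def by (rule M.units_group)
    interpret group_hom W "GL r" \<sigma> using \<sigma> by unfold_locales simp
    have "f [] = \<one>\<^bsub>W\<^esub>"
      using f_app[of "[]" "[]"] fW[of "[]"] by (simp add: W.r_cancel_one')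
    then have "\<sigma> (f u) = tits_word r m u" if "u \<in> words {..<r}" for u
      using that
    proof (induction u)
      case Nil
      then show ?case using hom_one GL by simp
    next
      case (Cons p u)
      obtain i b where p: "p = (i, b)" "i < r" using Cons by (cases p) auto
      have "f (p # u) = w i \<otimes>\<^bsub>W\<^esub> f u"
        using f_app[of "[p]" u] Cons p f_letter by simp
      moreover have "w i \<in> carrier W" using f_letter[OF p(2), of True] fW[of "[(i, True)]"] p by simp
      ultimately show ?case using Cons p \<sigma> GL fW hom_mult by simp
    qed
    then have "\<sigma> g = \<rho> g" if "g \<in> carrier W" for g
      using surj[OF that] \<rho>f by metis
    then show "\<sigma> = \<rho>"
      using \<sigma> by (intro extensionalityI[of _ "carrier W"]) (auto simp: \<rho>_def)
  qed
qed

end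

theory Submission
  imports Defs "HOL-Library.Function_Algebras" "HOL-Library.Z2" "HOL-Combinatorics.Permutations"
begin

text \<open>
  An irreducible system of rank at least three has three generators \<open>a = w i\<close>, \<open>b = w j\<close>,
  \<open>c = w k\<close> such that \<open>a b\<close> and \<open>b c\<close> have infinite order; for a twin group these are the
  first three generators. Killing the other generators and making
  \<open>a\<close> and \<open>c\<close> commute maps \<open>W\<close> onto \<open>(\<int>/2 \<times> \<int>/2) * \<int>/2\<close>, and from there onto finite 2-groups that
  contain elementary abelian subgroups of any rank, whereas the closure of \<open>W\<close> in
  \<open>GL(r, \<int>\<^sub>2)\<close> is a 2-adic analytic group, whose subgroups have bounded rank. So most of
  these finite 2-groups are not quotients of \<open>W\<close> by congruence conditions modulo powers of 2.

  The finite quotient is a group of permutations of \<open>\<int>/n \<times> \<int>/2\<close> with \<open>n\<close> a power of 2: the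
  generators \<open>c\<close> and \<open>b\<close> act by the reflections \<open>x \<mapsto> -x\<close> and \<open>x \<mapsto> 1 - x\<close> of the cycle
  \<open>\<int>/n\<close>, so that \<open>b c\<close> is the rotation by one, and \<open>a\<close> exchanges the two points above \<open>0\<close>.
  Conjugating a suitable product by powers of \<open>b c\<close> yields \<open>r\<^sup>2 + 1\<close> elements of \<open>W[4]\<close> that
  act as independent flips.

  The rank bound is an elimination procedure (\<open>exists_deep_pair\<close>). If \<open>g\<close> is
  \<open>1 + 2\<^sup>l X\<close> with \<open>l \<ge> 2\<close>, then squaring it keeps \<open>X\<close> modulo 2 and raises \<open>l\<close> by one. Among more than
  \<open>r\<^sup>2\<close> elements the leading terms \<open>X\<close> are linearly dependent modulo 2, so after raising
  some of them to powers of 2 their product is closer to 1, and it may replace one of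
  them without destroying the independence of the flips, because squares act trivially. Iterating,
  one finds for every \<open>e\<close> an element \<open>g \<in> W[2\<^sup>e]\<close> that acts nontrivially.

  It remains to deal with moduli \<open>2\<^sup>e k\<close> with \<open>k\<close> odd (\<open>odd_twist_edge\<close>). The Tits matrix of a
  product \<open>u = w p w q\<close> of infinite order is unipotent, and \<open>u\<^sup>s \<in> W[s]\<close> for every \<open>s\<close>. All
  elements above are products of such \<open>u\<close>. Replacing each factor \<open>u\<close> by \<open>u\<^sup>s\<close>, where \<open>s\<close> is divisible by
  \<open>k\<close> and congruent to 1 modulo a large power of 2, changes neither the matrix modulo \<open>2\<^sup>e\<close>
  nor the action, since \<open>u\<close> acts with order a power of 2, but makes the matrix trivial modulo
  \<open>k\<close>. So \<open>W[2\<^sup>e k]\<close> contains an element that acts nontrivially, for all \<open>e\<close> and \<open>k\<close>, and the kernel of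
  the action is a subgroup of finite index that contains no principal congruence subgroup.
\<close>

section \<open>Congruences between integer matrices\<close>

definition cong_mat :: "nat \<Rightarrow> int \<Rightarrow> int mat \<Rightarrow> int mat \<Rightarrow> bool" where
  "cong_mat r M A B \<longleftrightarrow> (\<forall>i<r. \<forall>j<r. [A $$ (i, j) = B $$ (i, j)] (mod M))"

lemma mat_mult_entry:
  assumes "A \<in> carrier_mat r r" "B \<in> carrier_mat r r" "i < r" "j < r"
  shows "(A * B) $$ (i, j) = (\<Sum>k<r. A $$ (i, k) * B $$ (k, j))"
  using assms by (auto simp: scalar_prod_def atLeast0LessThan intro!: sum.cong)

lemma cong_mat_refl: "cong_mat r M A A"
  by (simp add: cong_mat_def)

lemma cong_mat_trans: "cong_mat r M A B \<Longrightarrow> cong_mat r M B C \<Longrightarrow> cong_mat r M A C"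
  unfolding cong_mat_def by (blast intro: cong_trans)

lemma cong_mat_dvd: "cong_mat r M A B \<Longrightarrow> N dvd M \<Longrightarrow> cong_mat r N A B"
  unfolding cong_mat_def by (blast intro: cong_dvd_modulus)

lemma cong_mat_coprime:
  "coprime M N \<Longrightarrow> cong_mat r M A B \<Longrightarrow> cong_mat r N A B \<Longrightarrow> cong_mat r (M * N) A B"
  unfolding cong_mat_def by (blast intro: coprime_cong_mult)

lemma cong_mat_mult:
  assumes "A \<in> carrier_mat r r" "B \<in> carrier_mat r r" "A' \<in> carrier_mat r r" "B' \<in> carrier_mat r r"
    and "cong_mat r M A A'" "cong_mat r M B B'"
  shows "cong_mat r M (A * B) (A' * B')"
  unfolding cong_mat_def
proof (intro allI impI)
  fix i j assume "i < r" "j < r"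
  then show "[(A * B) $$ (i, j) = (A' * B') $$ (i, j)] (mod M)"
    unfolding mat_mult_entry[OF assms(1,2) \<open>i < r\<close> \<open>j < r\<close>] mat_mult_entry[OF assms(3,4) \<open>i < r\<close> \<open>j < r\<close>]
    using assms(5,6) by (intro cong_sum cong_mult) (simp_all add: cong_mat_def)
qed

text \<open>The difference to the identity matrix is what the 2-adic estimates are about: to first
  order it turns products of matrices into sums.\<close>

definition dev :: "nat \<Rightarrow> int mat \<Rightarrow> nat \<Rightarrow> nat \<Rightarrow> int" where
  "dev r A i j = A $$ (i, j) - 1\<^sub>m r $$ (i, j)"

lemma cong_mat_one_iff: "cong_mat r M A (1\<^sub>m r) \<longleftrightarrow> (\<forall>i<r. \<forall>j<r. M dvd dev r A i j)"
  by (simp add: cong_mat_def dev_def cong_iff_dvd_diff)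

lemma dev_mult:
  assumes "A \<in> carrier_mat r r" "B \<in> carrier_mat r r" "i < r" "j < r"
  shows "dev r (A * B) i j = dev r A i j + dev r B i j + (\<Sum>k<r. dev r A i k * dev r B k j)"
proof -
  have "(\<Sum>k<r. dev r A i k * dev r B k j)
    = (\<Sum>k<r. A $$ (i, k) * B $$ (k, j) - (if k = i then B $$ (k, j) else 0)
        - (if k = j then A $$ (i, k) else 0) + (if k = i then if i = j then 1 else 0 else 0))"
    using assms(3,4) by (intro sum.cong refl) (auto simp: dev_def algebra_simps)
  also have "\<dots> = (A * B) $$ (i, j) - B $$ (i, j) - A $$ (i, j) + (if i = j then 1 else 0)"
    using assms by (simp only: sum.distrib sum_subtractf sum.delta finite_lessThan lessThan_iff
      if_True mat_mult_entry[OF assms])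
  finally show ?thesis using assms(3,4) by (simp add: dev_def)
qed

lemma dev_mult_cong:
  assumes "A \<in> carrier_mat r r" "B \<in> carrier_mat r r" "i < r" "j < r"
    and "\<And>i j. i < r \<Longrightarrow> j < r \<Longrightarrow> M dvd dev r A i j"
    and "\<And>i j. i < r \<Longrightarrow> j < r \<Longrightarrow> N dvd dev r B i j"
  shows "[dev r (A * B) i j = dev r A i j + dev r B i j] (mod M * N)"
  unfolding dev_mult[OF assms(1-4)] cong_iff_dvd_diff
  using assms(3-) by (auto intro!: dvd_sum mult_dvd_mono)

section \<open>Elements close to the identity in the 2-adic topology\<close>

lemma sum_sym_diff:
  fixes f :: "'i \<Rightarrow> 'v::comm_monoid_add"
  assumes char2: "\<And>x::'v. x + x = 0" and "finite A" "finite B"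
  shows "sum f (sym_diff A B) = sum f A + sum f B"
proof -
  have "sum f A = sum f (A - B) + sum f (A \<inter> B)" "sum f B = sum f (B - A) + sum f (A \<inter> B)"
    using assms sum.Int_Diff[of A f B] sum.Int_Diff[of B f A] by (simp_all add: ac_simps Int_commute)
  moreover have "sum f (sym_diff A B) = sum f (A - B) + sum f (B - A)"
    using assms by (intro sum.union_disjoint) auto
  moreover have "(a + c) + (b + c) = a + b" for a b c :: 'v
    using char2[of c] by (simp add: ac_simps flip: add.assoc[of c c])
  ultimately show ?thesis by metis
qed

text \<open>A linear dependence over the field with two elements, found by the pigeonhole principle: two
  different subsets have the same sums modulo 2, and their symmetric difference works.\<close>

lemma parity_dependence:
  fixes X :: "'i \<Rightarrow> 'p \<Rightarrow> int"
  assumes "finite I" "finite Q" "card Q < card I"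
  shows "\<exists>T\<subseteq>I. T \<noteq> {} \<and> (\<forall>p\<in>Q. even (\<Sum>i\<in>T. X i p))"
proof -
  define F where "F T = (\<lambda>p\<in>Q. (\<Sum>i\<in>T. X i p) mod 2)" for T
  have "F ` Pow I \<subseteq> Q \<rightarrow>\<^sub>E {0, 1}" by (auto simp: F_def)
  then have "card (F ` Pow I) \<le> card (Q \<rightarrow>\<^sub>E {0, 1 :: int})"
    using assms(2) by (intro card_mono finite_PiE) auto
  also have "\<dots> = 2 ^ card Q" using assms(2) by (simp add: card_PiE numeral_2_eq_2)
  also have "\<dots> < card (Pow I)" using assms by (simp add: card_Pow)
  finally have "\<not> inj_on F (Pow I)" using pigeonhole by blast
  then obtain A B where AB: "A \<subseteq> I" "B \<subseteq> I" "A \<noteq> B" "F A = F B"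
    by (auto simp: inj_on_def)
  have fin: "finite A" "finite B" using AB assms(1) finite_subset by blast+
  have "even (\<Sum>i\<in>sym_diff A B. X i p)" if "p \<in> Q" for p
  proof -
    have "(\<Sum>i\<in>A. X i p) mod 2 = (\<Sum>i\<in>B. X i p) mod 2"
      using fun_cong[OF AB(4), of p] that by (simp add: F_def)
    moreover have "(\<Sum>i\<in>A. X i p) = (\<Sum>i\<in>A - B. X i p) + (\<Sum>i\<in>A \<inter> B. X i p)"
      "(\<Sum>i\<in>B. X i p) = (\<Sum>i\<in>B - A. X i p) + (\<Sum>i\<in>A \<inter> B. X i p)"
      using fin sum.Int_Diff[of A "\<lambda>i. X i p" B] sum.Int_Diff[of B "\<lambda>i. X i p" A]
      by (simp_all add: Int_commute)
    moreover have "(\<Sum>i\<in>sym_diff A B. X i p) = (\<Sum>i\<in>A - B. X i p) + (\<Sum>i\<in>B - A. X i p)"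
      using fin by (intro sum.union_disjoint) auto
    ultimately show ?thesis by presburger
  qed
  moreover have "sym_diff A B \<subseteq> I" "sym_diff A B \<noteq> {}" using AB by auto
  ultimately show ?thesis by (intro exI[of _ "sym_diff A B"]) simp
qed

text \<open>Matrices \<open>A\<close> congruent to 1 modulo 4, each with a label \<open>v\<close> in an elementary abelian 2-group
  that behaves like the image of \<open>A\<close> under a homomorphism; a set of pairs is used because the label
  belongs to a group element, of which \<open>A\<close> is only the matrix. The modulus 4 instead of 2
  is needed for the control of squares: \<open>(1 + 2 X)\<^sup>2 = 1 + 4 (X + X\<^sup>2)\<close>.\<close>

locale two_adic_pairs =
  fixes r :: nat and \<Gamma> :: "(int mat \<times> 'v::ab_group_add) set"
  assumes carrier: "(A, v) \<in> \<Gamma> \<Longrightarrow> A \<in> carrier_mat r r"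
    and closed: "(A, v) \<in> \<Gamma> \<Longrightarrow> (B, w) \<in> \<Gamma> \<Longrightarrow> (A * B, v + w) \<in> \<Gamma>"
    and level: "(A, v) \<in> \<Gamma> \<Longrightarrow> cong_mat r 4 A (1\<^sub>m r)"
    and char2: "(x :: 'v) + x = 0"
begin

text \<open>Since \<open>(1 + D)\<^sup>2 = 1 + 2 D + D\<^sup>2\<close> and \<open>D\<^sup>2\<close> is divisible by \<open>2\<^sup>2\<^sup>l\<close> with \<open>2 l \<ge> l + 2\<close>, the leading
  term survives each squaring, whereas the label vanishes at the first one.\<close>

lemma iterated_square:
  assumes "(A, v) \<in> \<Gamma>" "2 \<le> l" "\<And>i j. i < r \<Longrightarrow> j < r \<Longrightarrow> 2 ^ l dvd dev r A i j"
  shows "\<exists>B. (B, if m = 0 then v else 0) \<in> \<Gamma> \<and>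
    (\<forall>i<r. \<forall>j<r. [dev r B i j = 2 ^ m * dev r A i j] (mod 2 ^ (l + m + 1)))"
proof (induction m)
  case 0
  show ?case using assms by auto
next
  case (Suc m)
  then obtain B where B: "(B, if m = 0 then v else 0) \<in> \<Gamma>"
    and dev: "\<And>i j. i < r \<Longrightarrow> j < r \<Longrightarrow> [dev r B i j = 2 ^ m * dev r A i j] (mod 2 ^ (l + m + 1))"
    by blast
  have dvd: "2 ^ (l + m) dvd dev r B i j" if "i < r" "j < r" for i j
  proof -
    have "[dev r B i j = 2 ^ m * dev r A i j] (mod 2 ^ (l + m))"
      using dev[OF that] by (rule cong_dvd_modulus) (simp add: le_imp_power_dvd)
    moreover have "2 ^ (l + m) dvd 2 ^ m * dev r A i j"
      using assms(3)[OF that] by (simp add: power_add mult.commute mult_dvd_mono)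
    ultimately show ?thesis by (simp add: cong_dvd_iff)
  qed
  have "[dev r (B * B) i j = 2 ^ Suc m * dev r A i j] (mod 2 ^ (l + Suc m + 1))"
    if ij: "i < r" "j < r" for i j
  proof -
    have "[dev r (B * B) i j = dev r B i j + dev r B i j] (mod 2 ^ (l + m) * 2 ^ (l + m))"
      using carrier[OF B] ij dvd by (intro dev_mult_cong) auto
    then have "[dev r (B * B) i j = 2 * dev r B i j] (mod 2 ^ (l + Suc m + 1))"
      using assms(2) unfolding mult_2[of "dev r B i j"] power_add[symmetric]
      by (elim cong_dvd_modulus) (intro le_imp_power_dvd, simp)
    also have "[2 * dev r B i j = 2 * (2 ^ m * dev r A i j)] (mod 2 ^ (l + Suc m + 1))"
      using mult_dvd_mono[OF dvd_refl[of "2 :: int"] dev[OF ij, unfolded cong_iff_dvd_diff]]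
      by (simp add: cong_iff_dvd_diff right_diff_distrib)
    finally show ?thesis by (simp add: mult.assoc)
  qed
  moreover have "(B * B, 0) \<in> \<Gamma>" using closed[OF B B] by (simp only: char2)
  ultimately show ?case by (intro exI[of _ "B * B"]) simp
qed

text \<open>To first order the factors commute, so a product over an unordered index set makes sense; the error
  terms are divisible by \<open>2\<^sup>2\<^sup>L\<close>.\<close>

lemma product_level:
  assumes "finite S" "S \<noteq> {}" "1 \<le> L"
    and "\<And>i. i \<in> S \<Longrightarrow> (B i, w i) \<in> \<Gamma>"
    and "\<And>i p q. i \<in> S \<Longrightarrow> p < r \<Longrightarrow> q < r \<Longrightarrow> 2 ^ L dvd dev r (B i) p q"
  shows "\<exists>C. (C, \<Sum>i\<in>S. w i) \<in> \<Gamma> \<and>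
    (\<forall>p<r. \<forall>q<r. [dev r C p q = (\<Sum>i\<in>S. dev r (B i) p q)] (mod 2 ^ (L + 1)))"
  using assms(1,2,4,5)
proof (induction S rule: finite_ne_induct)
  case (singleton i)
  then show ?case by (intro exI[of _ "B i"]) simp
next
  case (insert i S)
  have "\<exists>C. (C, \<Sum>i\<in>S. w i) \<in> \<Gamma> \<and>
    (\<forall>p<r. \<forall>q<r. [dev r C p q = (\<Sum>i\<in>S. dev r (B i) p q)] (mod 2 ^ (L + 1)))"
    by (rule insert.IH) (simp_all add: insert.prems)
  then obtain C where C: "(C, \<Sum>i\<in>S. w i) \<in> \<Gamma>"
    and dev: "\<And>p q. p < r \<Longrightarrow> q < r \<Longrightarrow> [dev r C p q = (\<Sum>i\<in>S. dev r (B i) p q)] (mod 2 ^ (L + 1))"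
    by blast
  have Bi: "(B i, w i) \<in> \<Gamma>" using insert by simp
  have dvdC: "2 ^ L dvd dev r C p q" if "p < r" "q < r" for p q
  proof -
    have "[dev r C p q = (\<Sum>i\<in>S. dev r (B i) p q)] (mod 2 ^ L)"
      using dev[OF that] by (rule cong_dvd_modulus) (simp add: le_imp_power_dvd)
    moreover have "2 ^ L dvd (\<Sum>i\<in>S. dev r (B i) p q)"
      using insert.prems that by (intro dvd_sum) auto
    ultimately show ?thesis by (simp add: cong_dvd_iff)
  qed
  have "[dev r (B i * C) p q = (\<Sum>i\<in>insert i S. dev r (B i) p q)] (mod 2 ^ (L + 1))"
    if pq: "p < r" "q < r" for p q
  proof -
    have "[dev r (B i * C) p q = dev r (B i) p q + dev r C p q] (mod 2 ^ L * 2 ^ L)"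
      using carrier[OF C] carrier[OF Bi] pq dvdC insert.prems by (intro dev_mult_cong) auto
    then have "[dev r (B i * C) p q = dev r (B i) p q + dev r C p q] (mod 2 ^ (L + 1))"
      using assms(3) unfolding power_add[symmetric]
      by (elim cong_dvd_modulus) (intro le_imp_power_dvd, simp)
    also have "[dev r (B i) p q + dev r C p q
        = dev r (B i) p q + (\<Sum>i\<in>S. dev r (B i) p q)] (mod 2 ^ (L + 1))"
      by (rule cong_add[OF cong_refl dev[OF pq]])
    finally show ?thesis using insert.hyps by simp
  qed
  then show ?case using closed[OF Bi C] insert.hyps by (intro exI[of _ "B i * C"]) simp
qed

text \<open>The family is improved one member at a time until one of its matrices has level \<open>a\<close>, where
  the level of \<open>f i\<close> is the exponent \<open>l i\<close> of the power of 2 known to divide its difference to 1.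
  This is the statement that a subgroup of the kernel of reduction modulo 4 has no elementary abelian
  quotient of rank greater than \<open>r\<^sup>2\<close> that is continuous for the 2-adic topology.\<close>

lemma exists_deep_pair:
  assumes "r * r < N" "\<And>i. i < N \<Longrightarrow> (f i, v i) \<in> \<Gamma>"
    and "\<And>T. T \<subseteq> {..<N} \<Longrightarrow> T \<noteq> {} \<Longrightarrow> (\<Sum>i\<in>T. v i) \<noteq> 0"
  shows "\<exists>A v. (A, v) \<in> \<Gamma> \<and> v \<noteq> 0 \<and> cong_mat r (2 ^ a) A (1\<^sub>m r)"
proof -
  have claim: "\<exists>A v. (A, v) \<in> \<Gamma> \<and> v \<noteq> 0 \<and> (\<forall>i<r. \<forall>j<r. 2 ^ a dvd dev r A i j)"
    if "\<And>i. i < N \<Longrightarrow> (f i, v i) \<in> \<Gamma>"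
      and "\<And>T. T \<subseteq> {..<N} \<Longrightarrow> T \<noteq> {} \<Longrightarrow> (\<Sum>i\<in>T. v i) \<noteq> 0"
      and "\<And>i. i < N \<Longrightarrow> 2 \<le> l i"
      and "\<And>i p q. i < N \<Longrightarrow> p < r \<Longrightarrow> q < r \<Longrightarrow> 2 ^ l i dvd dev r (f i) p q"
    for f v and l :: "nat \<Rightarrow> nat"
    using that
  proof (induction "\<Sum>i<N. a - l i" arbitrary: f v l rule: less_induct)
    case less
    show ?case
    proof (cases "\<exists>i<N. a \<le> l i")
      case True
      then obtain i where i: "i < N" "a \<le> l i" by blast
      have "v i \<noteq> 0" using less.prems(2)[of "{i}"] i by simp
      moreover have "2 ^ a dvd dev r (f i) p q" if "p < r" "q < r" for p q
        using less.prems(4)[OF i(1) that] i(2) by (meson dvd_trans le_imp_power_dvd)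
      ultimately show ?thesis using less.prems(1)[OF i(1)] by blast
    next
      case False
      define X where "X i = (\<lambda>(p, q). dev r (f i) p q div 2 ^ l i)" for i
      have dX: "dev r (f i) p q = 2 ^ l i * X i (p, q)" if "i < N" "p < r" "q < r" for i p q
        using less.prems(4)[OF that] by (simp add: X_def)
      obtain S where S: "S \<subseteq> {..<N}" "S \<noteq> {}"
        and even: "\<And>p q. p < r \<Longrightarrow> q < r \<Longrightarrow> even (\<Sum>i\<in>S. X i (p, q))"
        using parity_dependence[of "{..<N}" "{..<r} \<times> {..<r}" X] assms(1)
        by (auto simp: card_cartesian_product)
      have finS: "finite S" using S finite_subset by blast
      define L where "L = Max (l ` S)"
      have "L \<in> l ` S" unfolding L_def using finS S by (intro Max_in) auto
      then obtain k where k: "k \<in> S" "l k = L" by auto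
      \<comment> \<open>Every member of the dependent subfamily is raised to the highest level \<open>L\<close>; the result will
        replace a member \<open>k\<close> that was at level \<open>L\<close> already, and so kept its label.\<close>
      have lL: "l i \<le> L" if "i \<in> S" for i unfolding L_def using finS that by simp
      have kN: "k < N" using k S by auto
      have L2: "2 \<le> L" using less.prems(3)[OF kN] k by simp
      define w where "w i = (if L - l i = 0 then v i else 0)" for i
      have "\<exists>B. (B, w i) \<in> \<Gamma> \<and>
        (\<forall>p<r. \<forall>q<r. [dev r B p q = 2 ^ L * X i (p, q)] (mod 2 ^ (L + 1)))" if i: "i \<in> S" for i
      proof -
        have iN: "i < N" using i S by auto
        have "2 ^ (L - l i) * dev r (f i) p q = 2 ^ L * X i (p, q)" if "p < r" "q < r" for p q
          using lL[OF i] by (simp add: dX[OF iN that] flip: power_add mult.assoc)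
        then show ?thesis
          using iterated_square[OF less.prems(1,3,4)[OF iN], of "L - l i"] lL[OF i]
          unfolding w_def by simp
      qed
      then obtain B where B: "\<And>i. i \<in> S \<Longrightarrow> (B i, w i) \<in> \<Gamma>"
        and devB: "\<And>i p q. i \<in> S \<Longrightarrow> p < r \<Longrightarrow> q < r \<Longrightarrow>
          [dev r (B i) p q = 2 ^ L * X i (p, q)] (mod 2 ^ (L + 1))" by metis
      have "2 ^ L dvd dev r (B i) p q" if "i \<in> S" "p < r" "q < r" for i p q
      proof -
        have "[dev r (B i) p q = 2 ^ L * X i (p, q)] (mod 2 ^ L)"
          using devB[OF that] by (rule cong_dvd_modulus) (simp add: le_imp_power_dvd)
        then show ?thesis by (simp add: cong_dvd_iff)
      qed
      then obtain C where C: "(C, \<Sum>i\<in>S. w i) \<in> \<Gamma>"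
        and devC: "\<And>p q. p < r \<Longrightarrow> q < r \<Longrightarrow>
          [dev r C p q = (\<Sum>i\<in>S. dev r (B i) p q)] (mod 2 ^ (L + 1))"
        using product_level[OF finS S(2), of L B w] B L2 by auto
      have dvdC: "2 ^ (L + 1) dvd dev r C p q" if pq: "p < r" "q < r" for p q
      proof -
        note devC[OF pq]
        also have "[(\<Sum>i\<in>S. dev r (B i) p q) = (\<Sum>i\<in>S. 2 ^ L * X i (p, q))] (mod 2 ^ (L + 1))"
          by (intro cong_sum devB pq)
        finally have "[dev r C p q = (\<Sum>i\<in>S. 2 ^ L * X i (p, q))] (mod 2 ^ (L + 1))" .
        moreover have "2 ^ (L + 1) dvd (\<Sum>i\<in>S. 2 ^ L * X i (p, q))"
          using even[OF pq] by (simp flip: sum_distrib_left)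
        ultimately show ?thesis using cong_dvd_iff by blast
      qed
      define T0 where "T0 = {i\<in>S. l i = L}"
      have T0: "(\<Sum>i\<in>S. w i) = (\<Sum>i\<in>T0. v i)"
      proof -
        have "(\<Sum>i\<in>S. w i) = (\<Sum>i\<in>S. if l i = L then v i else 0)"
          using lL unfolding w_def by (intro sum.cong refl) (auto simp: le_antisym)
        then show ?thesis using finS by (simp add: T0_def sum.inter_filter)
      qed
      have kT0: "k \<in> T0" "T0 \<subseteq> {..<N}" using k S by (auto simp: T0_def)
      let ?f = "f(k := C)" and ?v = "v(k := \<Sum>i\<in>S. w i)" and ?l = "l(k := L + 1)"
      show ?thesis
      proof (rule less.hyps[of ?l ?f ?v])
        show "(\<Sum>i<N. a - ?l i) < (\<Sum>i<N. a - l i)"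
          using kN k(2) False by (intro sum_strict_mono_ex1) (auto intro!: bexI[of _ k])
        show "(?f i, ?v i) \<in> \<Gamma>" if "i < N" for i using C less.prems(1)[OF that] by simp
        show "2 \<le> ?l i" if "i < N" for i using L2 less.prems(3)[OF that] by simp
        show "2 ^ ?l i dvd dev r (?f i) p q" if "i < N" "p < r" "q < r" for i p q
          using dvdC[OF that(2,3)] less.prems(4)[OF that] by simp
        show "(\<Sum>i\<in>T. ?v i) \<noteq> 0" if T: "T \<subseteq> {..<N}" "T \<noteq> {}" for T
        proof (cases "k \<in> T")
          case True
          have finT: "finite T" "finite T0" using T kT0 finite_subset by blast+
          have "(\<Sum>i\<in>T. ?v i) = ?v k + (\<Sum>i\<in>T - {k}. ?v i)"
            using finT True by (simp add: sum.remove)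
          also have "(\<Sum>i\<in>T - {k}. ?v i) = (\<Sum>i\<in>T - {k}. v i)" by (intro sum.cong) auto
          \<comment> \<open>The symmetric difference contains \<open>k\<close>, hence is not empty.\<close>
          also have "?v k + \<dots> = (\<Sum>i\<in>sym_diff T0 (T - {k}). v i)"
            using finT by (simp add: T0 sum_sym_diff[OF char2])
          also have "\<dots> \<noteq> 0" using T kT0 by (intro less.prems(2)) auto
          finally show ?thesis .
        next
          case False
          then have "(\<Sum>i\<in>T. ?v i) = (\<Sum>i\<in>T. v i)" by (intro sum.cong) auto
          then show ?thesis using less.prems(2)[OF T] by simp
        qed
      qed
    qed
  qed
  show ?thesis
    unfolding cong_mat_one_iff
  proof (rule claim[of f v "\<lambda>_. 2"])
    show "2 ^ 2 dvd dev r (f i) p q" if "i < N" "p < r" "q < r" for i p q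
      using level[OF assms(2)] that by (simp add: cong_mat_one_iff)
  qed (simp_all add: assms)
qed

end

section \<open>Right-angled Coxeter systems\<close>

text \<open>The isomorphism with the presented group, read as an evaluation of words in \<open>W\<close>.\<close>

lemma coxeter_system_words:
  assumes sys: "right_angled_coxeter_system W r w m"
  obtains f where
    "\<And>u. u \<in> words {..<r} \<Longrightarrow> f u \<in> carrier W"
    "\<And>g. g \<in> carrier W \<Longrightarrow> \<exists>u\<in>words {..<r}. f u = g"
    "\<And>u v. u \<in> words {..<r} \<Longrightarrow> v \<in> words {..<r} \<Longrightarrow> f (u @ v) = f u \<otimes>\<^bsub>W\<^esub> f v"
    "\<And>u v. u \<in> words {..<r} \<Longrightarrow> v \<in> words {..<r} \<Longrightarrow>
      f u = f v \<longleftrightarrow> pres_eq {..<r} (coxeter_relations r m) u v"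
    "\<And>i. i < r \<Longrightarrow> f [(i, True)] = w i"
proof -
  let ?R = "coxeter_relations r m"
  let ?P = "presented_group {..<r} ?R"
  let ?cl = "pres_class {..<r} ?R"
  obtain \<phi> where \<phi>: "\<phi> \<in> iso ?P W" and \<phi>w: "\<And>i. i < r \<Longrightarrow> \<phi> (?cl [(i, True)]) = w i"
    using sys by (auto simp: right_angled_coxeter_system_def coxeter_group_def coxeter_gen_def)
  have bij: "bij_betw \<phi> (carrier ?P) (carrier W)" and hom: "\<phi> \<in> hom ?P W"
    using \<phi> by (auto simp: iso_def)
  have carP: "carrier ?P = ?cl ` words {..<r}" by (simp add: presented_group_def)
  show thesis
  proof (rule that[of "\<lambda>u. \<phi> (?cl u)"])
    show "\<phi> (?cl u) \<in> carrier W" if "u \<in> words {..<r}" for u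
      using that hom carP by (auto simp: hom_def)
    show "\<exists>u\<in>words {..<r}. \<phi> (?cl u) = g" if "g \<in> carrier W" for g
    proof -
      have "g \<in> \<phi> ` ?cl ` words {..<r}"
        using that bij_betw_imp_surj_on[OF bij] carP by simp
      then show ?thesis by auto
    qed
    show "\<phi> (?cl (u @ v)) = \<phi> (?cl u) \<otimes>\<^bsub>W\<^esub> \<phi> (?cl v)"
      if "u \<in> words {..<r}" "v \<in> words {..<r}" for u v
      using hom_mult[OF hom, of "?cl u" "?cl v"] that carP by (simp add: pres_class_mult)
    show "\<phi> (?cl u) = \<phi> (?cl v) \<longleftrightarrow> pres_eq {..<r} ?R u v"
      if "u \<in> words {..<r}" "v \<in> words {..<r}" for u v
      using inj_on_eq_iff[OF bij_betw_imp_inj_on[OF bij], unfolded carP,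
          OF imageI[OF that(1)] imageI[OF that(2)]] that by (simp add: pres_class_eq)
    show "\<phi> (?cl [(i, True)]) = w i" if "i < r" for i by (rule \<phi>w[OF that])
  qed
qed

lemma coxeter_relation_word:
  assumes "(p, q) \<in> coxeter_relations r m" "right_angled_matrix r m"
  obtains (square) i where "i < r" "p = [(i, True), (i, True)]" "q = []"
    | (commutator) i j where "i < r" "j < r" "m i j = 2"
      "p = [(i, True), (j, True), (i, True), (j, True)]" "q = []"
proof -
  obtain i j k where ij: "i < r" "j < r" "m i j = enat k"
    "p = concat (replicate k [(i, True), (j, True)])" "q = []"
    using assms(1) by (auto simp: coxeter_relations_def)
  show thesis
  proof (cases "i = j")
    case True
    then have "k = 1" using ij assms(2) by (simp add: right_angled_matrix_def enat_eq_12)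
    then show thesis using ij True square by simp
  next
    case False
    then have "m i j \<in> {2, \<infinity>}" using ij(1,2) assms(2) unfolding right_angled_matrix_def by blast
    then have "m i j = 2" using ij(3) by auto
    then have "k = 2" using ij(3) enat_eq_12(2) by metis
    then show thesis using ij \<open>m i j = 2\<close> commutator by (simp add: numeral_2_eq_2)
  qed
qed

lemma coxeter_gen_closed:
  assumes sys: "right_angled_coxeter_system W r w m" and "i < r"
  shows "w i \<in> carrier W"
proof -
  obtain f where "\<And>u. u \<in> words {..<r} \<Longrightarrow> f u \<in> carrier W" "\<And>i. i < r \<Longrightarrow> f [(i, True)] = w i"
    using coxeter_system_words[OF sys] by metis
  from this(1)[of "[(i, True)]"] this(2)[OF assms(2)] assms(2) show ?thesis by simp
qed

lemma coxeter_gen_square: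
  assumes sys: "right_angled_coxeter_system W r w m" and i: "i < r"
  shows "w i \<otimes>\<^bsub>W\<^esub> w i = \<one>\<^bsub>W\<^esub>"
proof -
  interpret W: group W using sys by (simp add: right_angled_coxeter_system_def)
  have ra: "right_angled_matrix r m" using sys by (simp add: right_angled_coxeter_system_def)
  let ?R = "coxeter_relations r m"
  obtain f where f: "\<And>u. u \<in> words {..<r} \<Longrightarrow> f u \<in> carrier W"
    "\<And>u v. u \<in> words {..<r} \<Longrightarrow> v \<in> words {..<r} \<Longrightarrow> f (u @ v) = f u \<otimes>\<^bsub>W\<^esub> f v"
    "\<And>u v. u \<in> words {..<r} \<Longrightarrow> v \<in> words {..<r} \<Longrightarrow> f u = f v \<longleftrightarrow> pres_eq {..<r} ?R u v"
    "\<And>i. i < r \<Longrightarrow> f [(i, True)] = w i"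
    by (rule coxeter_system_words[OF sys]) (rule that)
  have "(concat (replicate 1 [(i, True), (i, True)]), []) \<in> ?R"
    using i ra unfolding coxeter_relations_def
    by (intro CollectI exI[of _ i] exI[of _ 1]) (auto simp: right_angled_matrix_def enat_eq_12)
  then have "pres_eq {..<r} ?R [(i, True), (i, True)] []"
    using i pres_eq.pe_rel[of "[]" "{..<r}" "[]" _ _ ?R] by auto
  then have "f ([(i, True)] @ [(i, True)]) = f []" using i f(3) by simp
  moreover have "f [] = \<one>\<^bsub>W\<^esub>"
    using f(2)[of "[]" "[]"] f(1)[of "[]"] by (simp add: W.r_cancel_one')
  ultimately show ?thesis using i f(2)[of "[(i, True)]" "[(i, True)]"] f(4) by simp
qed

lemma coxeter_gen_commute:
  assumes sys: "right_angled_coxeter_system W r w m" and ij: "i < r" "j < r" "m i j = 2"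
  shows "w i \<otimes>\<^bsub>W\<^esub> w j = w j \<otimes>\<^bsub>W\<^esub> w i"
proof -
  interpret W: group W using sys by (simp add: right_angled_coxeter_system_def)
  let ?R = "coxeter_relations r m" and ?ij = "[(i, True), (j, True)]"
  obtain f where f: "\<And>u. u \<in> words {..<r} \<Longrightarrow> f u \<in> carrier W"
    "\<And>u v. u \<in> words {..<r} \<Longrightarrow> v \<in> words {..<r} \<Longrightarrow> f (u @ v) = f u \<otimes>\<^bsub>W\<^esub> f v"
    "\<And>u v. u \<in> words {..<r} \<Longrightarrow> v \<in> words {..<r} \<Longrightarrow> f u = f v \<longleftrightarrow> pres_eq {..<r} ?R u v"
    "\<And>i. i < r \<Longrightarrow> f [(i, True)] = w i"
    by (rule coxeter_system_words[OF sys]) (rule that)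
  have w: "w i \<in> carrier W" "w j \<in> carrier W" using coxeter_gen_closed[OF sys] ij by auto
  have sq: "w i \<otimes>\<^bsub>W\<^esub> w i = \<one>\<^bsub>W\<^esub>" "w j \<otimes>\<^bsub>W\<^esub> w j = \<one>\<^bsub>W\<^esub>"
    using coxeter_gen_square[OF sys] ij by auto
  have "(concat (replicate 2 ?ij), []) \<in> ?R"
    using ij unfolding coxeter_relations_def
    by (intro CollectI exI[of _ i] exI[of _ j] exI[of _ 2]) (auto simp: numeral_eq_enat)
  then have "pres_eq {..<r} ?R (?ij @ ?ij) []"
    using ij pres_eq.pe_rel[of "[]" "{..<r}" "[]" _ _ ?R] by (auto simp: numeral_2_eq_2)
  then have "f (?ij @ ?ij) = f []" using ij f(3) by simp
  moreover have "f [] = \<one>\<^bsub>W\<^esub>"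
    using f(2)[of "[]" "[]"] f(1)[of "[]"] by (simp add: W.r_cancel_one')
  moreover have "f ?ij = w i \<otimes>\<^bsub>W\<^esub> w j"
    using f(2)[of "[(i, True)]" "[(j, True)]"] f(4) ij by simp
  ultimately have "(w i \<otimes>\<^bsub>W\<^esub> w j) \<otimes>\<^bsub>W\<^esub> (w i \<otimes>\<^bsub>W\<^esub> w j) = \<one>\<^bsub>W\<^esub>"
    using f(2)[of ?ij ?ij] ij by simp
  then have "w i \<otimes>\<^bsub>W\<^esub> w j = inv\<^bsub>W\<^esub> (w i \<otimes>\<^bsub>W\<^esub> w j)"
    using w by (simp add: W.inv_equality)
  also have "\<dots> = inv\<^bsub>W\<^esub> w j \<otimes>\<^bsub>W\<^esub> inv\<^bsub>W\<^esub> w i" using w by (simp add: W.inv_mult_group)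
  also have "\<dots> = w j \<otimes>\<^bsub>W\<^esub> w i" using w sq by (simp add: W.inv_equality)
  finally show ?thesis .
qed

lemma coxeter_system_induct:
  assumes sys: "right_angled_coxeter_system W r w m" and g: "g \<in> carrier W"
    and one: "P \<one>\<^bsub>W\<^esub>"
    and step: "\<And>i g. i < r \<Longrightarrow> g \<in> carrier W \<Longrightarrow> P g \<Longrightarrow> P (w i \<otimes>\<^bsub>W\<^esub> g)"
  shows "P g"
proof -
  interpret W: group W using sys by (simp add: right_angled_coxeter_system_def)
  let ?R = "coxeter_relations r m"
  obtain f where f: "\<And>u. u \<in> words {..<r} \<Longrightarrow> f u \<in> carrier W"
    "\<And>g. g \<in> carrier W \<Longrightarrow> \<exists>u\<in>words {..<r}. f u = g"
    "\<And>u v. u \<in> words {..<r} \<Longrightarrow> v \<in> words {..<r} \<Longrightarrow> f (u @ v) = f u \<otimes>\<^bsub>W\<^esub> f v"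
    "\<And>u v. u \<in> words {..<r} \<Longrightarrow> v \<in> words {..<r} \<Longrightarrow> f u = f v \<longleftrightarrow> pres_eq {..<r} ?R u v"
    "\<And>i. i < r \<Longrightarrow> f [(i, True)] = w i"
    by (rule coxeter_system_words[OF sys]) (rule that)
  have f1: "f [] = \<one>\<^bsub>W\<^esub>"
    using f(3)[of "[]" "[]"] f(1)[of "[]"] by (simp add: W.r_cancel_one')
  have letter: "f [(i, b)] = w i" if i: "i < r" for i b
  proof (cases b)
    case True
    then show ?thesis using f(5) i by simp
  next
    case False
    have "pres_eq {..<r} ?R ([(i, False)] @ [(i, True)]) []"
      using pres_eq.pe_cancel[of "[]" "{..<r}" "[]" i ?R False] i by simp
    then have "f ([(i, False)] @ [(i, True)]) = f []" using f(4) i by simp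
    then have "f [(i, False)] \<otimes>\<^bsub>W\<^esub> w i = w i \<otimes>\<^bsub>W\<^esub> w i"
      using f(3)[of "[(i, False)]" "[(i, True)]"] f(5) f1 i coxeter_gen_square[OF sys i] by simp
    then show ?thesis
      using False i f(1)[of "[(i, False)]"] coxeter_gen_closed[OF sys i] by simp
  qed
  have "P (f u)" if "u \<in> words {..<r}" for u
    using that
  proof (induction u)
    case Nil
    show ?case using one f1 by simp
  next
    case (Cons p u)
    obtain i b where p: "p = (i, b)" "i < r" using Cons by (cases p) auto
    have "f (p # u) = w i \<otimes>\<^bsub>W\<^esub> f u" using f(3)[of "[p]" u] Cons p letter by simp
    then show ?case using step[OF p(2) f(1)] Cons by simp
  qed
  then show ?thesis using f(2)[OF g] by blast
qed

text \<open>The universal property of the presentation; for a right-angled matrix the relations say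
  only that generators are involutions and that some of them commute.\<close>

lemma coxeter_hom_exists:
  assumes sys: "right_angled_coxeter_system W r w m" and K: "group K"
    and \<kappa>: "\<And>i. i < r \<Longrightarrow> \<kappa> i \<in> carrier K"
    and sq: "\<And>i. i < r \<Longrightarrow> \<kappa> i \<otimes>\<^bsub>K\<^esub> \<kappa> i = \<one>\<^bsub>K\<^esub>"
    and comm: "\<And>i j. i < r \<Longrightarrow> j < r \<Longrightarrow> m i j = 2 \<Longrightarrow> \<kappa> i \<otimes>\<^bsub>K\<^esub> \<kappa> j = \<kappa> j \<otimes>\<^bsub>K\<^esub> \<kappa> i"
  shows "\<exists>\<phi>\<in>hom W K. \<forall>i<r. \<phi> (w i) = \<kappa> i"
proof -
  interpret W: group W using sys by (simp add: right_angled_coxeter_system_def)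
  interpret K: group K by (rule K)
  have ra: "right_angled_matrix r m" using sys by (simp add: right_angled_coxeter_system_def)
  let ?R = "coxeter_relations r m"
  obtain f where f: "\<And>u. u \<in> words {..<r} \<Longrightarrow> f u \<in> carrier W"
    "\<And>g. g \<in> carrier W \<Longrightarrow> \<exists>u\<in>words {..<r}. f u = g"
    "\<And>u v. u \<in> words {..<r} \<Longrightarrow> v \<in> words {..<r} \<Longrightarrow> f (u @ v) = f u \<otimes>\<^bsub>W\<^esub> f v"
    "\<And>u v. u \<in> words {..<r} \<Longrightarrow> v \<in> words {..<r} \<Longrightarrow> f u = f v \<longleftrightarrow> pres_eq {..<r} ?R u v"
    "\<And>i. i < r \<Longrightarrow> f [(i, True)] = w i"
    by (rule coxeter_system_words[OF sys]) (rule that)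
  define ev where "ev u = foldr (\<lambda>p x. \<kappa> (fst p) \<otimes>\<^bsub>K\<^esub> x) u \<one>\<^bsub>K\<^esub>" for u :: "nat word"
  have ev_simps [simp]: "ev [] = \<one>\<^bsub>K\<^esub>" "ev (p # u) = \<kappa> (fst p) \<otimes>\<^bsub>K\<^esub> ev u" for p u
    by (simp_all add: ev_def)
  have ev_closed [simp]: "ev u \<in> carrier K" if "u \<in> words {..<r}" for u
    using that by (induction u) (auto simp: \<kappa>)
  have ev_append: "ev (u @ v) = ev u \<otimes>\<^bsub>K\<^esub> ev v" if "u \<in> words {..<r}" "v \<in> words {..<r}" for u v
    using that by (induction u) (auto simp: \<kappa> K.m_assoc)
  have ev_rel: "ev p = \<one>\<^bsub>K\<^esub>" "q = []" if "(p, q) \<in> ?R" for p q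
    using that ra
  proof (atomize(full), cases rule: coxeter_relation_word)
    case (square i)
    then show "ev p = \<one>\<^bsub>K\<^esub> \<and> q = []" using \<kappa> sq by simp
  next
    case (commutator i j)
    have "\<kappa> i \<otimes>\<^bsub>K\<^esub> (\<kappa> j \<otimes>\<^bsub>K\<^esub> (\<kappa> i \<otimes>\<^bsub>K\<^esub> \<kappa> j)) = \<kappa> i \<otimes>\<^bsub>K\<^esub> (\<kappa> j \<otimes>\<^bsub>K\<^esub> (\<kappa> j \<otimes>\<^bsub>K\<^esub> \<kappa> i))"
      by (simp only: comm[OF commutator(1-3)])
    also have "\<dots> = \<kappa> i \<otimes>\<^bsub>K\<^esub> ((\<kappa> j \<otimes>\<^bsub>K\<^esub> \<kappa> j) \<otimes>\<^bsub>K\<^esub> \<kappa> i)"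
      using \<kappa> commutator by (simp add: K.m_assoc)
    also have "\<dots> = \<one>\<^bsub>K\<^esub>" using \<kappa> sq commutator by simp
    finally show "ev p = \<one>\<^bsub>K\<^esub> \<and> q = []" using \<kappa> commutator by simp
  qed
  have ev_cong: "ev u = ev v" if "pres_eq {..<r} ?R u v" for u v
    using that
  proof (induction rule: pres_eq.induct)
    case (pe_cancel u v x b)
    then show ?case using sq[of x] \<kappa>[of x] by (simp add: ev_append flip: K.m_assoc)
  next
    case (pe_rel u v p q)
    then show ?case using ev_rel[OF pe_rel(3)] by (simp add: ev_append)
  qed auto
  define \<phi> where "\<phi> g = ev (SOME u. u \<in> words {..<r} \<and> f u = g)" for g
  have \<phi>f: "\<phi> (f u) = ev u" if "u \<in> words {..<r}" for u
  proof -
    let ?v = "SOME v. v \<in> words {..<r} \<and> f v = f u"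
    have "?v \<in> words {..<r} \<and> f ?v = f u" by (rule someI[of _ u]) (simp add: that)
    then show ?thesis using f(4) ev_cong that unfolding \<phi>_def by blast
  qed
  have "\<phi> \<in> hom W K"
  proof (rule homI)
    show "\<phi> g \<in> carrier K" if "g \<in> carrier W" for g using f(2)[OF that] \<phi>f by auto
    show "\<phi> (g \<otimes>\<^bsub>W\<^esub> h) = \<phi> g \<otimes>\<^bsub>K\<^esub> \<phi> h" if gh: "g \<in> carrier W" "h \<in> carrier W" for g h
    proof -
      obtain u v where "u \<in> words {..<r}" "f u = g" "v \<in> words {..<r}" "f v = h"
        using f(2) gh by blast
      then show ?thesis using \<phi>f f(3)[of u v] ev_append[of u v] words_append by metis
    qed
  qed
  moreover have "\<phi> (w i) = \<kappa> i" if "i < r" for i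
    using \<phi>f[of "[(i, True)]"] f(5)[OF that] \<kappa>[OF that] that by simp
  ultimately show ?thesis by blast
qed

section \<open>The integral Tits representation\<close>

lemma tits_rep_hom:
  assumes "right_angled_coxeter_system W r w m"
  shows "tits_rep W r w m \<in> hom W (GL r)"
    and "\<And>i. i < r \<Longrightarrow> tits_rep W r w m (w i) = tits_matrix r m i"
proof -
  have "tits_rep W r w m \<in> hom W (GL r) \<inter> extensional (carrier W) \<and>
      (\<forall>i<r. tits_rep W r w m (w i) = tits_matrix r m i)"
    unfolding tits_rep_def by (rule theI'[OF tits_rep_well_defined[OF assms]])
  then show "tits_rep W r w m \<in> hom W (GL r)"
    and "\<And>i. i < r \<Longrightarrow> tits_rep W r w m (w i) = tits_matrix r m i" by blast+
qed

lemma GL_simps: "mult (GL r) = (*)" "one (GL r) = 1\<^sub>m r"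
  by (simp_all add: GL_def units_of_def ring_mat_simps)

lemma GL_carrier: "A \<in> carrier (GL r) \<Longrightarrow> A \<in> carrier_mat r r"
  by (auto simp: GL_def units_of_def Units_def ring_mat_simps)

lemma tits_coeff_integral:
  assumes "right_angled_matrix r m" "i < r" "j < r"
  shows "\<exists>x::int. tits_coeff m i j = of_int x"
proof -
  have "m i j = 1" if "i = j" using that assms by (simp add: right_angled_matrix_def)
  moreover have "m i j \<in> {2, \<infinity>}" if "i \<noteq> j"
    using that assms unfolding right_angled_matrix_def by blast
  ultimately consider "m i j = 1" | "m i j = 2" | "m i j = \<infinity>" by fastforce
  then show ?thesis
  proof cases
    case 1
    then show ?thesis by (intro exI[of _ 1]) (simp add: tits_coeff_simps)
  next
    case 2
    then show ?thesis by (intro exI[of _ 0]) (simp add: tits_coeff_simps)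
  next
    case 3
    then show ?thesis by (intro exI[of _ "-1"]) (simp add: tits_coeff_def)
  qed
qed

lemma tits_rep_one:
  assumes sys: "right_angled_coxeter_system W r w m"
  shows "tits_rep W r w m \<one>\<^bsub>W\<^esub> = 1\<^sub>m r"
proof -
  interpret W: group W using sys by (simp add: right_angled_coxeter_system_def)
  interpret M: ring "ring_mat TYPE(real) r ()" by (rule ring_mat)
  interpret G: group "GL r" unfolding GL_def by (rule M.units_group)
  interpret group_hom W "GL r" "tits_rep W r w m" using tits_rep_hom(1)[OF sys] by unfold_locales
  show ?thesis using hom_one GL_simps by simp
qed

lemma tits_rep_integral:
  assumes sys: "right_angled_coxeter_system W r w m" and "g \<in> carrier W"
  shows "\<exists>A\<in>carrier_mat r r. tits_rep W r w m g = map_mat real_of_int A"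
  using assms(2)
proof (induction rule: coxeter_system_induct[OF sys, consumes 1, case_names one step])
  case one
  show ?case
    unfolding tits_rep_one[OF sys] by (intro bexI[of _ "1\<^sub>m r"]) (auto simp: of_int_hom.mat_hom_one)
next
  case (step i g)
  have ra: "right_angled_matrix r m" using sys by (simp add: right_angled_coxeter_system_def)
  obtain A where A: "A \<in> carrier_mat r r" "tits_rep W r w m g = map_mat real_of_int A"
    using step by blast
  define T where "T = mat r r (\<lambda>(a, b). \<lfloor>tits_matrix r m i $$ (a, b)\<rfloor>)"
  have carT: "T \<in> carrier_mat r r" by (simp add: T_def)
  have T: "tits_matrix r m i = map_mat real_of_int T"
  proof (rule eq_matI)
    fix a b assume "a < dim_row (map_mat real_of_int T)" "b < dim_col (map_mat real_of_int T)"
    then have ab: "a < r" "b < r" by (auto simp: T_def)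
    obtain x :: int where "tits_coeff m i b = of_int x"
      using tits_coeff_integral[OF ra step(1) ab(2)] by blast
    then have "tits_matrix r m i $$ (a, b)
        = of_int ((if a = b then 1 else 0) - (if a = i then 2 * x else 0))"
      using tits_matrix_index[OF step(1) ab] by simp
    then show "tits_matrix r m i $$ (a, b) = map_mat real_of_int T $$ (a, b)"
      using ab unfolding T_def by simp
  qed (use carrier_matD[OF tits_matrix_carrier[of r m i]] in \<open>simp_all add: T_def\<close>)
  have "tits_rep W r w m (w i \<otimes>\<^bsub>W\<^esub> g) = tits_matrix r m i * tits_rep W r w m g"
    using hom_mult[OF tits_rep_hom(1)[OF sys] coxeter_gen_closed[OF sys step(1)] step(2)]
      tits_rep_hom(2)[OF sys step(1)] GL_simps by simp
  also have "\<dots> = map_mat real_of_int (T * A)"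
    by (simp only: A(2) T of_int_hom.mat_hom_mult[OF carT A(1)])
  finally show ?case using mult_carrier_mat[OF carT A(1)] by blast
qed

text \<open>The entries of the Tits representation are integers, so that taking floors only changes the type.\<close>

definition int_rep ::
    "('a, 'b) monoid_scheme \<Rightarrow> nat \<Rightarrow> (nat \<Rightarrow> 'a) \<Rightarrow> (nat \<Rightarrow> nat \<Rightarrow> enat) \<Rightarrow> 'a \<Rightarrow> int mat" where
  "int_rep W r w m g = map_mat floor (tits_rep W r w m g)"

lemma tits_rep_eq_int_rep:
  assumes "right_angled_coxeter_system W r w m" "g \<in> carrier W"
  shows "int_rep W r w m g \<in> carrier_mat r r"
    and "tits_rep W r w m g = map_mat real_of_int (int_rep W r w m g)"
proof -
  obtain A where A: "A \<in> carrier_mat r r" "tits_rep W r w m g = map_mat real_of_int A"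
    using tits_rep_integral[OF assms] by blast
  moreover have "map_mat floor (map_mat real_of_int A) = A" by (rule eq_matI) auto
  ultimately show "int_rep W r w m g \<in> carrier_mat r r"
    "tits_rep W r w m g = map_mat real_of_int (int_rep W r w m g)"
    by (simp_all add: int_rep_def)
qed

lemma int_rep_mult:
  assumes sys: "right_angled_coxeter_system W r w m" and gh: "g \<in> carrier W" "h \<in> carrier W"
  shows "int_rep W r w m (g \<otimes>\<^bsub>W\<^esub> h) = int_rep W r w m g * int_rep W r w m h"
proof -
  interpret W: group W using sys by (simp add: right_angled_coxeter_system_def)
  have "map_mat real_of_int (int_rep W r w m (g \<otimes>\<^bsub>W\<^esub> h))
      = map_mat real_of_int (int_rep W r w m g * int_rep W r w m h)"
    using hom_mult[OF tits_rep_hom(1)[OF sys] gh] tits_rep_eq_int_rep[OF sys] gh GL_simps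
    by (simp add: of_int_hom.mat_hom_mult[of _ r r _ r])
  then show ?thesis by (rule of_int_hom.mat_hom_inj)
qed

lemma int_rep_one:
  assumes "right_angled_coxeter_system W r w m"
  shows "int_rep W r w m \<one>\<^bsub>W\<^esub> = 1\<^sub>m r"
  unfolding int_rep_def tits_rep_one[OF assms] by (rule eq_matI) auto

lemma principal_congruence_subgroupI:
  assumes "right_angled_coxeter_system W r w m" "g \<in> carrier W"
    and "cong_mat r (int k) (int_rep W r w m g) (1\<^sub>m r)"
  shows "g \<in> principal_congruence_subgroup W r w m k"
proof -
  note \<rho> = tits_rep_eq_int_rep[OF assms(1,2)]
  show ?thesis
    unfolding principal_congruence_subgroup_def
    using assms(2,3) by (intro CollectI conjI bexI[OF _ \<rho>(1)] \<rho>(2)) (simp_all add: cong_mat_def)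
qed

text \<open>The diagonal entry at \<open>i\<close> of a generating Tits matrix is \<open>-1\<close> for the \<open>i\<close>-th generator and 1
  for all others.\<close>

lemma coxeter_gen_inj:
  assumes sys: "right_angled_coxeter_system W r w m"
  shows "inj_on w {..<r}"
proof (rule inj_onI, rule ccontr)
  fix i j assume ij: "i \<in> {..<r}" "j \<in> {..<r}" "w i = w j" "i \<noteq> j"
  have ra: "right_angled_matrix r m" using sys by (simp add: right_angled_coxeter_system_def)
  then have "tits_coeff m i i = 1" using ij by (simp add: right_angled_matrix_def tits_coeff_simps)
  moreover have "tits_matrix r m i = tits_matrix r m j"
    using tits_rep_hom(2)[OF sys, of i] tits_rep_hom(2)[OF sys, of j] ij by simp
  ultimately show False
    using ij tits_matrix_index[of i r i i m] tits_matrix_index[of j r i i m] by simp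
qed

text \<open>On the plane spanned by \<open>e\<^sub>i\<close> and \<open>e\<^sub>j\<close> the form is degenerate with radical \<open>e\<^sub>i + e\<^sub>j\<close>, so the product
  of the two reflections is unipotent and the entries of its powers are quadratic polynomials in \<open>n\<close>.\<close>

lemma tits_rep_infinite_edge_pow:
  assumes sys: "right_angled_coxeter_system W r w m"
    and ij: "i < r" "j < r" "m i j = \<infinity>" and ab: "a < r" "b < r"
  defines "\<alpha> \<equiv> tits_coeff m i b" and "\<beta> \<equiv> tits_coeff m j b"
  shows "tits_rep W r w m ((w i \<otimes>\<^bsub>W\<^esub> w j) [^]\<^bsub>W\<^esub> n) $$ (a, b) = (if a = b then 1 else 0)
    - (if a = i then 2 * real n * (real n * (\<alpha> + \<beta>) + \<beta>) else 0)
    - (if a = j then 2 * real n * (real n * (\<alpha> + \<beta>) - \<alpha>) else 0)"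
  using ab unfolding \<alpha>_def \<beta>_def
proof (induction n arbitrary: a b)
  case 0
  then show ?case by (simp add: tits_rep_one[OF sys])
next
  case (Suc n)
  interpret W: group W using sys by (simp add: right_angled_coxeter_system_def)
  have ra: "right_angled_matrix r m" using sys by (simp add: right_angled_coxeter_system_def)
  let ?\<rho> = "tits_rep W r w m" and ?t = "w i \<otimes>\<^bsub>W\<^esub> w j"
  note hom = tits_rep_hom[OF sys]
  have w: "w i \<in> carrier W" "w j \<in> carrier W" using coxeter_gen_closed[OF sys] ij by auto
  have mji: "m j i = \<infinity>" using ra ij by (simp add: right_angled_matrix_def)
  then have ne: "i \<noteq> j" using ra ij by (auto simp: right_angled_matrix_def one_enat_def)
  have c: "tits_coeff m i i = 1" "tits_coeff m j j = 1"
    "tits_coeff m i j = -1" "tits_coeff m j i = -1"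
  proof -
    have "m i i = 1" "m j j = 1" using ra ij by (auto simp: right_angled_matrix_def)
    then show "tits_coeff m i i = 1" "tits_coeff m j j = 1" by (simp_all add: tits_coeff_simps)
    show "tits_coeff m i j = -1" "tits_coeff m j i = -1" using ij mji by (simp_all add: tits_coeff_def)
  qed
  define X where "X = 2 * tits_coeff m i b + 4 * tits_coeff m j b"
  define Y where "Y = 2 * tits_coeff m j b"
  have t: "?\<rho> ?t $$ (k, b) = (if k = b then 1 else 0) - (if k = i then X else 0)
      - (if k = j then Y else 0)" if "k < r" for k
  proof -
    have "?\<rho> ?t = tits_matrix r m i * tits_matrix r m j"
      using hom_mult[OF hom(1) w] hom(2) ij GL_simps by simp
    then show ?thesis
      using tits_matrix_mult_index[OF ij(1,2) that Suc.prems(2), of m] ne by (simp add: X_def Y_def c)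
  qed
  let ?M = "?\<rho> (?t [^]\<^bsub>W\<^esub> n)"
  have car: "?M \<in> carrier_mat r r" "?\<rho> ?t \<in> carrier_mat r r"
    using hom_in_carrier[OF hom(1)] w by (auto intro!: GL_carrier)
  have "?\<rho> (?t [^]\<^bsub>W\<^esub> Suc n) = ?M * ?\<rho> ?t"
    using hom_mult[OF hom(1), of "?t [^]\<^bsub>W\<^esub> n" ?t] w GL_simps by simp
  then have "?\<rho> (?t [^]\<^bsub>W\<^esub> Suc n) $$ (a, b) = (\<Sum>k<r. ?M $$ (a, k) * ?\<rho> ?t $$ (k, b))"
    using Suc.prems car by (auto simp: scalar_prod_def atLeast0LessThan intro!: sum.cong)
  also have "\<dots> = (\<Sum>k<r. (if k = b then ?M $$ (a, b) else 0) - (if k = i then ?M $$ (a, i) * X else 0)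
      - (if k = j then ?M $$ (a, j) * Y else 0))"
    by (intro sum.cong refl) (auto simp: t algebra_simps)
  also have "\<dots> = ?M $$ (a, b) - ?M $$ (a, i) * X - ?M $$ (a, j) * Y"
    using ij Suc.prems
    by (simp only: sum_subtractf sum.delta finite_lessThan lessThan_iff if_True)
  finally have e: "?\<rho> (?t [^]\<^bsub>W\<^esub> Suc n) $$ (a, b) = ?M $$ (a, b) - ?M $$ (a, i) * X - ?M $$ (a, j) * Y" .
  have eqs: "?M $$ (a, i) = (if a = i then 1 + 2 * real n else 0) + (if a = j then 2 * real n else 0)"
    "?M $$ (a, j) = (if a = j then 1 - 2 * real n else 0) - (if a = i then 2 * real n else 0)"
    using Suc.IH[OF Suc.prems(1) ij(1)] Suc.IH[OF Suc.prems(1) ij(2)] ne by (simp_all add: c)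
  consider "a = i" "a \<noteq> j" | "a = j" "a \<noteq> i" | "a \<noteq> i" "a \<noteq> j" using ne by blast
  then show ?case
    unfolding e eqs Suc.IH[OF Suc.prems] X_def Y_def
    by cases (simp_all add: algebra_simps)
qed

text \<open>Apart from the identity matrix, these polynomials have even coefficients and no constant term.\<close>

lemma int_rep_infinite_edge_pow:
  assumes sys: "right_angled_coxeter_system W r w m"
    and ij: "i < r" "j < r" "m i j = \<infinity>"
  shows "cong_mat r (2 * int n) (int_rep W r w m ((w i \<otimes>\<^bsub>W\<^esub> w j) [^]\<^bsub>W\<^esub> n)) (1\<^sub>m r)"
  unfolding cong_mat_def
proof (intro allI impI)
  interpret W: group W using sys by (simp add: right_angled_coxeter_system_def)
  have ra: "right_angled_matrix r m" using sys by (simp add: right_angled_coxeter_system_def)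
  fix a b assume ab: "a < r" "b < r"
  obtain x y :: int where xy: "tits_coeff m i b = of_int x" "tits_coeff m j b = of_int y"
    using tits_coeff_integral[OF ra] ij ab by metis
  let ?g = "(w i \<otimes>\<^bsub>W\<^esub> w j) [^]\<^bsub>W\<^esub> n"
  have g: "?g \<in> carrier W" using coxeter_gen_closed[OF sys] ij by simp
  have "real_of_int (int_rep W r w m ?g $$ (a, b)) = tits_rep W r w m ?g $$ (a, b)"
    using tits_rep_eq_int_rep[OF sys g] ab by simp
  also have "\<dots> = real_of_int ((if a = b then 1 else 0)
    - 2 * int n * ((if a = i then int n * (x + y) + y else 0)
       + (if a = j then int n * (x + y) - x else 0)))"
    unfolding tits_rep_infinite_edge_pow[OF sys ij ab] xy by (auto simp: algebra_simps)
  finally have "int_rep W r w m ?g $$ (a, b) = 1\<^sub>m r $$ (a, b)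
    - 2 * int n * ((if a = i then int n * (x + y) + y else 0)
       + (if a = j then int n * (x + y) - x else 0))"
    unfolding of_int_eq_iff using ab by simp
  then show "[int_rep W r w m ?g $$ (a, b) = 1\<^sub>m r $$ (a, b)] (mod 2 * int n)"
    by (simp add: cong_iff_dvd_diff)
qed

text \<open>The graph of the pairs with \<open>m p q = \<infinity>\<close> is connected; so there is an edge between \<open>0\<close> and some \<open>j\<close>, and
  another edge that joins one of these two vertices to a third one.\<close>

lemma irreducible_system_path:
  assumes sys: "right_angled_coxeter_system W r w m"
    and irr: "irreducible_system W (w ` {..<r})" and r: "r > 2"
  obtains i j k where "i < r" "j < r" "k < r" "m i j = \<infinity>" "m j k = \<infinity>" "i \<noteq> k"
proof -
  have ra: "right_angled_matrix r m" using sys by (simp add: right_angled_coxeter_system_def)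
  have inj: "inj_on w {..<r}" by (rule coxeter_gen_inj[OF sys])
  have sym: "m q p = \<infinity>" if "p < r" "q < r" "m p q = \<infinity>" for p q
    using that ra by (simp add: right_angled_matrix_def)
  have edge: "\<exists>p\<in>I. \<exists>q\<in>{..<r} - I. m p q = \<infinity>" if I: "I \<subseteq> {..<r}" "I \<noteq> {}" "{..<r} - I \<noteq> {}" for I
  proof (rule ccontr)
    assume no: "\<not> ?thesis"
    have "w p \<otimes>\<^bsub>W\<^esub> w q = w q \<otimes>\<^bsub>W\<^esub> w p" if pq: "p \<in> I" "q \<in> {..<r} - I" for p q
    proof -
      have "p < r" "q < r" "p \<noteq> q" using pq I by auto
      then have "m p q \<in> {2, \<infinity>}" using ra unfolding right_angled_matrix_def by blast
      then have "m p q = 2" using no pq by blast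
      then show ?thesis using coxeter_gen_commute[OF sys] \<open>p < r\<close> \<open>q < r\<close> by blast
    qed
    moreover have "w ` I \<inter> w ` ({..<r} - I) = {}"
      using inj_on_image_Int[OF inj I(1), of "{..<r} - I"] by auto
    moreover have "w ` I \<union> w ` ({..<r} - I) = w ` {..<r}" using I by auto
    ultimately have "\<not> irreducible_system W (w ` {..<r})"
      using I unfolding irreducible_system_def not_not
      by (intro exI[of _ "w ` I"] exI[of _ "w ` ({..<r} - I)"] conjI) auto
    then show False using irr by simp
  qed
  have "1 \<in> {..<r} - {0}" using r by simp
  then have "{..<r} - {0} \<noteq> {}" by blast
  then obtain j where j: "0 < j" "j < r" "m 0 j = \<infinity>"
    using edge[of "{0}"] r by auto
  have "(if j = 1 then 2 else 1) \<in> {..<r} - {0, j}" using r by simp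
  then have "{..<r} - {0, j} \<noteq> {}" by blast
  moreover have "{0, j} \<subseteq> {..<r}" using r j by simp
  ultimately obtain p k where p: "p \<in> {0, j}" and k: "k \<in> {..<r} - {0, j}" and pk: "m p k = \<infinity>"
    using edge[of "{0, j}"] by blast
  have k': "k < r" "k \<noteq> 0" "k \<noteq> j" using k by simp_all
  show thesis
  proof (cases "p = j")
    case True
    then show thesis using that[of 0 j k] j k' pk r by simp
  next
    case False
    then have "m 0 k = \<infinity>" using p pk by simp
    then show thesis using that[of j 0 k] j k' sym[of 0 j] r by simp
  qed
qed

section \<open>Flips and rotations of a cycle with two layers\<close>

definition perm_group :: "'x set \<Rightarrow> ('x \<Rightarrow> 'x) monoid" where
  "perm_group \<Omega> = \<lparr>carrier = {p. p permutes \<Omega>}, mult = (\<circ>), one = id\<rparr>"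

lemma perm_group_simps [simp]:
  "p \<in> carrier (perm_group \<Omega>) \<longleftrightarrow> p permutes \<Omega>"
  "p \<otimes>\<^bsub>perm_group \<Omega>\<^esub> q = p \<circ> q" "\<one>\<^bsub>perm_group \<Omega>\<^esub> = id"
  by (simp_all add: perm_group_def)

lemma group_perm_group: "group (perm_group \<Omega>)"
proof (rule groupI)
  fix p assume "p \<in> carrier (perm_group \<Omega>)"
  then show "\<exists>q\<in>carrier (perm_group \<Omega>). q \<otimes>\<^bsub>perm_group \<Omega>\<^esub> p = \<one>\<^bsub>perm_group \<Omega>\<^esub>"
    using permutes_inv[of p \<Omega>] permutes_inv_o(2)[of p \<Omega>]
    by (intro bexI[of _ "Hilbert_Choice.inv p"]) simp_all
qed (auto simp: permutes_id permutes_compose o_assoc)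

lemma perm_group_pow: "p [^]\<^bsub>perm_group \<Omega>\<^esub> n = p ^^ n" for n :: nat
  by (induction n) (simp_all add: nat_pow_def funpow_Suc_right del: funpow.simps)

lemma (in group_hom) finite_rcosets_kernel:
  assumes "finite (carrier H)"
  shows "finite (rcosets (kernel G H h))"
proof -
  have "(\<lambda>X. the_elem (h ` X)) ` carrier (G Mod kernel G H h) \<subseteq> carrier H"
    using FactGroup_the_elem_mem by blast
  then have "finite (carrier (G Mod kernel G H h))"
    using FactGroup_inj_on assms by (meson inj_on_finite)
  then show ?thesis by (simp add: FactGroup_def)
qed

text \<open>Permutations of \<open>X \<times> \<int>/2\<close>: \<open>flip v\<close> exchanges the two points above each \<open>x\<close> with \<open>v x = 1\<close>, and
  \<open>lift \<pi>\<close> moves the fibres by \<open>\<pi>\<close>. The flips form the elementary abelian base group, written with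
  values in the field \<open>bit\<close> so that composition becomes addition.\<close>

definition flip :: "('x \<Rightarrow> bit) \<Rightarrow> 'x \<times> bit \<Rightarrow> 'x \<times> bit" where
  "flip v = (\<lambda>(x, e). (x, e + v x))"

definition lift :: "('x \<Rightarrow> 'x) \<Rightarrow> 'x \<times> bit \<Rightarrow> 'x \<times> bit" where
  "lift \<pi> = (\<lambda>(x, e). (\<pi> x, e))"

lemma bit_fun_add_self: "v + v = (0 :: 'x \<Rightarrow> bit)"
proof
  fix x show "(v + v) x = 0 x" by (cases "v x") simp_all
qed

lemma flip_flip: "flip v \<circ> flip u = flip (v + u)"
  by (auto simp: flip_def fun_eq_iff ac_simps)

lemma flip_eq_id: "flip v = id \<longleftrightarrow> v = 0"
  by (auto simp: flip_def fun_eq_iff)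

lemma lift_lift: "lift \<pi> \<circ> lift \<sigma> = lift (\<pi> \<circ> \<sigma>)"
  by (auto simp: lift_def fun_eq_iff)

lemma lift_id: "lift id = id"
  by (auto simp: lift_def fun_eq_iff)

lemma lift_flip: "(\<And>x. u (\<pi> x) = v x) \<Longrightarrow> lift \<pi> \<circ> flip v = flip u \<circ> lift \<pi>"
  by (auto simp: lift_def flip_def fun_eq_iff)

text \<open>Reflections and rotations of the cycle \<open>\<int>/n\<close>, represented by \<open>{0..<n}\<close> and extended by the identity
  as permutations have to be.\<close>

definition mod_refl :: "int \<Rightarrow> int \<Rightarrow> int \<Rightarrow> int" where
  "mod_refl n c x = (if x \<in> {0..<n} then (c - x) mod n else x)"

definition mod_rot :: "int \<Rightarrow> int \<Rightarrow> int \<Rightarrow> int" where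
  "mod_rot n k x = (if x \<in> {0..<n} then (x + k) mod n else x)"

lemma mod_refl_refl: "mod_refl n c \<circ> mod_refl n d = mod_rot n (c - d)"
  by (auto simp: mod_refl_def mod_rot_def fun_eq_iff mod_simps algebra_simps)

lemma mod_refl_rot: "mod_refl n c \<circ> mod_rot n k = mod_refl n (c - k)"
  by (auto simp: mod_refl_def mod_rot_def fun_eq_iff mod_simps algebra_simps)

lemma mod_rot_rot: "mod_rot n k \<circ> mod_rot n l = mod_rot n (k + l)"
  by (auto simp: mod_rot_def fun_eq_iff mod_simps algebra_simps)

lemma mod_rot_id: "n dvd k \<Longrightarrow> mod_rot n k = id"
  by (auto simp: mod_rot_def fun_eq_iff mod_simps elim!: dvdE)

lemma mod_rot_pow: "mod_rot n k ^^ j = mod_rot n (int j * k)"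
  by (induction j) (simp_all add: mod_rot_id mod_rot_rot algebra_simps)

lemma lift_pow: "lift \<pi> ^^ j = lift (\<pi> ^^ j)"
proof (induction j)
  case 0
  show ?case by (simp only: funpow.simps lift_id)
next
  case (Suc j)
  then show ?case by (simp only: funpow.simps lift_lift)
qed

lemma involution_permutes:
  assumes "p \<circ> p = id" "\<And>x. x \<notin> \<Omega> \<Longrightarrow> p x = x"
  shows "p permutes \<Omega>"
  using assms unfolding permutes_def
  by (metis comp_apply id_apply)

definition delta :: "int \<Rightarrow> int \<Rightarrow> bit" where
  "delta c x = (if x = c then 1 else 0)"

lemma flip_delta_permutes: "c \<in> X \<Longrightarrow> flip (delta c) permutes X \<times> UNIV"
  by (rule involution_permutes) (auto simp: flip_flip bit_fun_add_self flip_eq_id flip_def delta_def)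

lemma lift_mod_refl_permutes: "lift (mod_refl n c) permutes {0..<n} \<times> UNIV"
proof (rule involution_permutes)
  show "lift (mod_refl n c) \<circ> lift (mod_refl n c) = id" by (simp add: lift_lift mod_refl_refl mod_rot_id lift_id)
qed (auto simp: lift_def mod_refl_def)

lemma lift_mod_rot_flip_delta:
  assumes "0 \<le> c" "c < n" "0 \<le> c + k" "c + k < n"
  shows "lift (mod_rot n k) \<circ> flip (delta c) = flip (delta (c + k)) \<circ> lift (mod_rot n k)"
proof (rule lift_flip)
  fix x
  have "mod_rot n (- k) (mod_rot n k x) = x"
    using fun_cong[OF mod_rot_rot[of n "- k" k], of x] by (simp add: mod_rot_id)
  moreover have "mod_rot n k c = c + k" "mod_rot n (- k) (c + k) = c" using assms by (simp_all add: mod_rot_def)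
  ultimately have "mod_rot n k x = c + k \<longleftrightarrow> x = c" by auto
  then show "delta (c + k) (mod_rot n k x) = delta c x" by (simp add: delta_def)
qed

lemma lift_mod_refl_flip_delta:
  assumes "0 \<le> c" "c < n" "0 \<le> d - c" "d - c < n"
  shows "lift (mod_refl n d) \<circ> flip (delta c) = flip (delta (d - c)) \<circ> lift (mod_refl n d)"
proof (rule lift_flip)
  fix x
  have "mod_refl n d (mod_refl n d x) = x"
    using fun_cong[OF mod_refl_refl[of n d d], of x] by (simp add: mod_rot_id)
  moreover have "mod_refl n d c = d - c" "mod_refl n d (d - c) = c" using assms by (simp_all add: mod_refl_def)
  ultimately have "mod_refl n d x = d - c \<longleftrightarrow> x = c" by auto
  then show "delta (d - c) (mod_refl n d x) = delta c x" by (simp add: delta_def)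
qed

lemma sum_fun_apply: "(\<Sum>l\<in>T. v l) x = (\<Sum>l\<in>T. v l x)"
  by (induction T rule: infinite_finite_induct) simp_all

text \<open>The supports \<open>{4 l, 4 l + 2}\<close> are disjoint.\<close>

lemma delta_pairs_independent:
  assumes "T \<noteq> {}" "finite T"
  shows "(\<Sum>l\<in>T. delta (4 * int l) + delta (4 * int l + 2)) \<noteq> 0"
proof
  assume 0: "(\<Sum>l\<in>T. delta (4 * int l) + delta (4 * int l + 2)) = 0"
  obtain l where l: "l \<in> T" using assms by blast
  have "(\<Sum>l'\<in>T. delta (4 * int l') + delta (4 * int l' + 2)) (4 * int l)
      = (\<Sum>l'\<in>T. if l' = l then 1 else 0)"
  proof (subst sum_fun_apply, intro sum.cong refl)
    fix l'
    have "4 * int l \<noteq> 4 * int l' + 2" by presburger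
    then show "(delta (4 * int l') + delta (4 * int l' + 2)) (4 * int l) = (if l' = l then 1 else 0)"
      by (auto simp: delta_def)
  qed
  also have "\<dots> = 1" using l assms(2) by simp
  finally show False using 0 by simp
qed

section \<open>Removing the odd part of the modulus\<close>

text \<open>The element \<open>g\<close> can be replaced by one that lies in \<open>W[k]\<close> and cannot be distinguished from \<open>g\<close> by
  \<open>\<phi>\<close> or modulo \<open>2\<^sup>a\<close>. In this sense the factor \<open>k\<close> of a modulus \<open>2\<^sup>a k\<close> can be
  ignored.\<close>

definition odd_twist ::
    "('a, 'b) monoid_scheme \<Rightarrow> nat \<Rightarrow> (nat \<Rightarrow> 'a) \<Rightarrow> (nat \<Rightarrow> nat \<Rightarrow> enat) \<Rightarrow> ('a \<Rightarrow> 'k) \<Rightarrow> nat \<Rightarrow> nat \<Rightarrow> 'a \<Rightarrow> bool" where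
  "odd_twist W r w m \<phi> k a g \<longleftrightarrow> (\<exists>h\<in>carrier W. \<phi> h = \<phi> g \<and>
     cong_mat r (int k) (int_rep W r w m h) (1\<^sub>m r) \<and>
     cong_mat r (2 ^ a) (int_rep W r w m h) (int_rep W r w m g))"

lemma odd_twist_mult:
  assumes sys: "right_angled_coxeter_system W r w m" and \<phi>: "\<phi> \<in> hom W K"
    and gh: "g \<in> carrier W" "h \<in> carrier W"
    and g: "odd_twist W r w m \<phi> k a g" and h: "odd_twist W r w m \<phi> k a h"
  shows "odd_twist W r w m \<phi> k a (g \<otimes>\<^bsub>W\<^esub> h)"
proof -
  interpret W: group W using sys by (simp add: right_angled_coxeter_system_def)
  let ?\<rho> = "int_rep W r w m"
  note car = tits_rep_eq_int_rep(1)[OF sys] and mult = int_rep_mult[OF sys]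
  obtain g' where g': "g' \<in> carrier W" "\<phi> g' = \<phi> g" "cong_mat r (int k) (?\<rho> g') (1\<^sub>m r)"
    "cong_mat r (2 ^ a) (?\<rho> g') (?\<rho> g)" using g unfolding odd_twist_def by blast
  obtain h' where h': "h' \<in> carrier W" "\<phi> h' = \<phi> h" "cong_mat r (int k) (?\<rho> h') (1\<^sub>m r)"
    "cong_mat r (2 ^ a) (?\<rho> h') (?\<rho> h)" using h unfolding odd_twist_def by blast
  have "cong_mat r (int k) (?\<rho> (g' \<otimes>\<^bsub>W\<^esub> h')) (1\<^sub>m r * 1\<^sub>m r)"
    unfolding mult[OF g'(1) h'(1)]
    by (intro cong_mat_mult car g' h' one_carrier_mat)
  moreover have "cong_mat r (2 ^ a) (?\<rho> (g' \<otimes>\<^bsub>W\<^esub> h')) (?\<rho> (g \<otimes>\<^bsub>W\<^esub> h))"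
    unfolding mult[OF g'(1) h'(1)] mult[OF gh]
    by (intro cong_mat_mult car g' h' gh)
  moreover have "\<phi> (g' \<otimes>\<^bsub>W\<^esub> h') = \<phi> (g \<otimes>\<^bsub>W\<^esub> h)"
    using hom_mult[OF \<phi>] g' h' gh by simp
  ultimately show ?thesis
    using g'(1) h'(1) unfolding odd_twist_def by (intro bexI[of _ "g' \<otimes>\<^bsub>W\<^esub> h'"]) simp_all
qed

text \<open>By the Chinese remainder theorem there is an exponent \<open>s\<close> divisible by \<open>k\<close> and congruent to 1
  modulo a common multiple of \<open>2\<^sup>a\<close> and of the order of the image of \<open>u = w p w q\<close>; then \<open>u\<^sup>s\<close>
  is the replacement.\<close>

lemma odd_twist_edge:
  assumes sys: "right_angled_coxeter_system W r w m" and \<phi>: "group_hom W K \<phi>"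
    and pq: "p < r" "q < r" "m p q = \<infinity>"
    and ord: "\<phi> (w p \<otimes>\<^bsub>W\<^esub> w q) [^]\<^bsub>K\<^esub> ((2::nat) ^ e) = \<one>\<^bsub>K\<^esub>" and k: "odd k"
  shows "odd_twist W r w m \<phi> k a (w p \<otimes>\<^bsub>W\<^esub> w q)"
proof -
  interpret group_hom W K \<phi> by (rule \<phi>)
  let ?\<rho> = "int_rep W r w m" and ?u = "w p \<otimes>\<^bsub>W\<^esub> w q"
  have u: "?u \<in> carrier W" using coxeter_gen_closed[OF sys] pq by simp
  note car = tits_rep_eq_int_rep(1)[OF sys] and mult = int_rep_mult[OF sys]
  note pow = int_rep_infinite_edge_pow[OF sys pq]
  define M where "M = (2::nat) ^ Suc (a + e)"
  have "coprime k M" using k by (simp add: M_def)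
  then obtain x where x: "[k * x = 1] (mod M)"
    using cong_solve_coprime_nat[of k M] unfolding One_nat_def by blast
  define s where "s = k * x"
  have "M \<noteq> 1" by (simp add: M_def)
  then have "s \<noteq> 0" using x cong_0_1_nat unfolding s_def by metis
  then have s1: "s = Suc (s - 1)" by simp
  have "M dvd s - 1" using x \<open>s \<noteq> 0\<close> unfolding s_def[symmetric]
    by (simp add: cong_altdef_nat)
  then obtain y where y: "s - 1 = M * y" by blast
  have split: "?u [^]\<^bsub>W\<^esub> s = ?u [^]\<^bsub>W\<^esub> (s - 1) \<otimes>\<^bsub>W\<^esub> ?u"
    using s1 G.nat_pow_Suc by metis
  have "cong_mat r (int k) (?\<rho> (?u [^]\<^bsub>W\<^esub> s)) (1\<^sub>m r)"
    by (rule cong_mat_dvd[OF pow]) (simp add: s_def)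
  moreover have "cong_mat r (2 ^ a) (?\<rho> (?u [^]\<^bsub>W\<^esub> s)) (1\<^sub>m r * ?\<rho> ?u)"
  proof -
    have "2 * int (s - 1) = 2 ^ a * (4 * 2 ^ e * int y)"
      unfolding y M_def by (simp add: power_add)
    then have "cong_mat r (2 ^ a) (?\<rho> (?u [^]\<^bsub>W\<^esub> (s - 1))) (1\<^sub>m r)"
      by (intro cong_mat_dvd[OF pow] dvdI)
    then show ?thesis
      unfolding split using u by (subst mult) (auto intro!: cong_mat_mult car cong_mat_refl)
  qed
  moreover have "\<phi> (?u [^]\<^bsub>W\<^esub> s) = \<phi> ?u"
  proof -
    have "\<phi> (?u [^]\<^bsub>W\<^esub> (s - 1)) = (\<phi> ?u [^]\<^bsub>K\<^esub> ((2::nat) ^ e)) [^]\<^bsub>K\<^esub> (2 * 2 ^ a * y)"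
      unfolding y using u by (simp add: hom_nat_pow H.nat_pow_pow M_def power_add ac_simps)
    also have "\<dots> = \<one>\<^bsub>K\<^esub>" by (simp add: ord)
    finally show ?thesis unfolding split using u by simp
  qed
  ultimately show ?thesis
    using u left_mult_one_mat[OF car[OF u]] unfolding odd_twist_def
    by (intro bexI[of _ "?u [^]\<^bsub>W\<^esub> s"]) simp_all
qed

section \<open>Failure of the congruence subgroup property\<close>

text \<open>The kernel of the action on the cycle with two layers is the subgroup of finite index that
  contains no principal congruence subgroup.\<close>

theorem path_not_congruence_subgroup_property:
  assumes sys: "right_angled_coxeter_system W r w m"
    and ijk: "i < r" "j < r" "k < r" "m i j = \<infinity>" "m j k = \<infinity>" "i \<noteq> k"
  shows "\<not> has_congruence_subgroup_property W r w m"
proof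
  assume csp: "has_congruence_subgroup_property W r w m"
  interpret W: group W using sys by (simp add: right_angled_coxeter_system_def)
  have ra: "right_angled_matrix r m" using sys by (simp add: right_angled_coxeter_system_def)
  have mji: "m j i = \<infinity>" and mkj: "m k j = \<infinity>"
    using ra ijk by (simp_all add: right_angled_matrix_def)
  have ne: "i \<noteq> j" "j \<noteq> k"
    using ra ijk by (auto simp: right_angled_matrix_def one_enat_def)
  \<comment> \<open>One element more than the rank bound allows; their supports \<open>{4 l, 4 l + 2}\<close> have to fit into the
    cycle, and since \<open>b c\<close> acts with order \<open>n\<close>, this has to be a power of 2.\<close>
  define N where "N = Suc (r * r)"
  define n where "n = (2 :: int) ^ (4 * N)"
  have "int (4 * N) < 2 ^ (4 * N)" by (rule of_nat_less_two_power)
  then have n: "4 * int N < n" by (simp add: n_def)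
  have "0 < N" by (simp add: N_def)
  then have n4: "4 < n" using n by linarith
  define \<Omega> where "\<Omega> = {0..<n} \<times> (UNIV :: bit set)"
  define K where "K = perm_group \<Omega>"
  interpret K: group K unfolding K_def by (rule group_perm_group)
  have K_simps: "\<And>p. p \<in> carrier K \<longleftrightarrow> p permutes \<Omega>" "\<And>p q. p \<otimes>\<^bsub>K\<^esub> q = p \<circ> q"
    "\<one>\<^bsub>K\<^esub> = id" by (simp_all add: K_def)
  have K_pow: "p [^]\<^bsub>K\<^esub> l = p ^^ l" for p and l :: nat by (simp add: K_def perm_group_pow)
  define a where "a = flip (delta 0)"
  define b where "b = lift (mod_refl n 1)"
  define c where "c = lift (mod_refl n 0)"
  define \<kappa> where "\<kappa> l = (if l = i then a else if l = j then b else if l = k then c else id)" for l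
  have perm: "a permutes \<Omega>" "b permutes \<Omega>" "c permutes \<Omega>"
    using n unfolding a_def b_def c_def \<Omega>_def
    by (simp_all add: flip_delta_permutes lift_mod_refl_permutes)
  have sq: "a \<circ> a = id" "b \<circ> b = id" "c \<circ> c = id"
    unfolding a_def b_def c_def
    by (simp_all only: flip_flip bit_fun_add_self flip_eq_id lift_lift mod_refl_refl)
      (simp_all add: mod_rot_id lift_id)
  have ac: "a \<circ> c = c \<circ> a"
    unfolding a_def c_def using n lift_mod_refl_flip_delta[of 0 n 0] by simp
  have "\<exists>\<phi>\<in>hom W K. \<forall>l<r. \<phi> (w l) = \<kappa> l"
  proof (rule coxeter_hom_exists[OF sys])
    show "group K" by (rule K.is_group)
    show "\<kappa> l \<in> carrier K" if "l < r" for l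
      using perm permutes_id by (simp add: \<kappa>_def K_simps)
    show "\<kappa> l \<otimes>\<^bsub>K\<^esub> \<kappa> l = \<one>\<^bsub>K\<^esub>" if "l < r" for l
      using sq by (simp add: \<kappa>_def K_simps)
    show "\<kappa> p \<otimes>\<^bsub>K\<^esub> \<kappa> q = \<kappa> q \<otimes>\<^bsub>K\<^esub> \<kappa> p" if "m p q = 2" for p q
      using that ijk mji mkj ac unfolding \<kappa>_def K_simps by auto
  qed
  then obtain \<phi> where \<phi>: "\<phi> \<in> hom W K" and \<phi>w: "\<And>l. l < r \<Longrightarrow> \<phi> (w l) = \<kappa> l" by blast
  interpret \<phi>: group_hom W K \<phi> using \<phi> by unfold_locales
  have "subgroup (kernel W K \<phi>) W" by (rule \<phi>.subgroup_kernel)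
  moreover have "finite (carrier K)"
  proof -
    have "finite (UNIV :: bit set)"
    proof -
      have "(UNIV :: bit set) = {0, 1}" using bit_not_zero_iff by blast
      then show ?thesis by (metis finite.simps)
    qed
    then show ?thesis by (simp add: K_def perm_group_def \<Omega>_def finite_permutations)
  qed
  then have "finite (rcosets\<^bsub>W\<^esub> (kernel W K \<phi>))" by (rule \<phi>.finite_rcosets_kernel)
  ultimately obtain k0 where k0: "k0 \<ge> 2"
    and sub: "principal_congruence_subgroup W r w m k0 \<subseteq> kernel W K \<phi>"
    using csp unfolding has_congruence_subgroup_property_def by blast
  obtain k1 where k1: "k0 = 2 ^ multiplicity 2 k0 * k1" "odd k1"
    using multiplicity_decompose'[of k0 2] k0 by auto
  define e where "e = multiplicity 2 k0"

  let ?\<rho> = "int_rep W r w m" and ?Q = "odd_twist W r w m \<phi> k1 e"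
  note car = tits_rep_eq_int_rep(1)[OF sys] and mult = int_rep_mult[OF sys]
  have w: "w i \<in> carrier W" "w j \<in> carrier W" "w k \<in> carrier W"
    using coxeter_gen_closed[OF sys] ijk by auto
  have wsq: "w i \<otimes>\<^bsub>W\<^esub> w i = \<one>\<^bsub>W\<^esub>" "w j \<otimes>\<^bsub>W\<^esub> w j = \<one>\<^bsub>W\<^esub>"
    using coxeter_gen_square[OF sys] ijk by auto
  have \<phi>abc: "\<phi> (w i) = a" "\<phi> (w j) = b" "\<phi> (w k) = c"
    using \<phi>w ijk ne by (simp_all add: \<kappa>_def)
  define ab where "ab = w i \<otimes>\<^bsub>W\<^esub> w j"
  define ba where "ba = w j \<otimes>\<^bsub>W\<^esub> w i"
  define bc where "bc = w j \<otimes>\<^bsub>W\<^esub> w k"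
  define cb where "cb = w k \<otimes>\<^bsub>W\<^esub> w j"
  note defs = ab_def ba_def bc_def cb_def
  have cl [simp]: "ab \<in> carrier W" "ba \<in> carrier W" "bc \<in> carrier W" "cb \<in> carrier W"
    using w by (simp_all add: defs)
  have \<phi>edge: "\<phi> ab = a \<circ> b" "\<phi> ba = b \<circ> a" "\<phi> bc = lift (mod_rot n 1)" "\<phi> cb = lift (mod_rot n (-1))"
    using w by (simp_all add: defs \<phi>abc K_simps) (simp_all add: b_def c_def lift_lift mod_refl_refl)

  have ord_bc: "\<phi> bc ^^ nat n = id" "\<phi> cb ^^ nat n = id"
    using n by (simp_all add: \<phi>edge lift_pow mod_rot_pow mod_rot_id lift_id)
  have aba: "b \<circ> a \<circ> b = flip (delta 1)"
  proof -
    have "b \<circ> a = flip (delta 1) \<circ> b"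
      unfolding a_def b_def using n4 lift_mod_refl_flip_delta[of 0 n 1] by simp
    then show ?thesis by (simp add: o_assoc[symmetric] sq)
  qed
  have "p ^^ 4 = id" if "p \<circ> p = flip v" for p v
  proof -
    have "p ^^ 4 = (p \<circ> p) \<circ> (p \<circ> p)" by (simp add: numeral_eq_Suc fun_eq_iff)
    then show ?thesis unfolding that flip_flip bit_fun_add_self by (simp only: flip_eq_id)
  qed
  moreover have "(a \<circ> b) \<circ> (a \<circ> b) = flip (delta 0 + delta 1)"
    unfolding flip_flip[symmetric] aba[symmetric] a_def[symmetric] by (simp only: o_assoc)
  moreover have "(b \<circ> a) \<circ> (b \<circ> a) = flip (delta 1 + delta 0)"
    unfolding flip_flip[symmetric] aba[symmetric] a_def[symmetric] by (simp only: o_assoc)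
  ultimately have ord_ab: "\<phi> ab ^^ 4 = id" "\<phi> ba ^^ 4 = id"
    unfolding \<phi>edge by blast+
  have n': "nat n = 2 ^ (4 * N)" by (simp add: n_def nat_power_eq)
  have Q: "?Q ab" "?Q ba" "?Q bc" "?Q cb"
    using odd_twist_edge[OF sys \<phi>.group_hom_axioms _ _ _ _ k1(2), of _ _ 2 e]
      odd_twist_edge[OF sys \<phi>.group_hom_axioms _ _ _ _ k1(2), of _ _ "4 * N" e]
      ijk mji mkj ord_bc ord_ab unfolding K_pow K_simps n' defs by simp_all
  have Q_mult: "?Q (g \<otimes>\<^bsub>W\<^esub> h)" if "g \<in> carrier W" "h \<in> carrier W" "?Q g" "?Q h" for g h
    by (rule odd_twist_mult[OF sys \<phi> that])
  have Q_one: "?Q \<one>\<^bsub>W\<^esub>"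
    unfolding odd_twist_def int_rep_one[OF sys]
    by (intro bexI[of _ "\<one>\<^bsub>W\<^esub>"]) (simp_all add: int_rep_one[OF sys] cong_mat_refl)
  have Q_pow: "?Q (g [^]\<^bsub>W\<^esub> l)" if "g \<in> carrier W" "?Q g" for g and l :: nat
    using that by (induction l) (simp_all add: Q_one Q_mult)

  \<comment> \<open>In \<open>W\<close> this is the product of \<open>a (b c)\<^sup>2 a\<close> and \<open>(b c)\<^sup>-\<^sup>2\<close>, written in terms of elements to which
    \<open>odd_twist_edge\<close> applies. It lies in \<open>W[4]\<close> because \<open>(b c)\<^sup>2\<close> does, and it acts as the product of the
    flips at \<open>0\<close> and at its translate \<open>2\<close>.\<close>
  define z where "z = ab \<otimes>\<^bsub>W\<^esub> cb [^]\<^bsub>W\<^esub> (2::nat) \<otimes>\<^bsub>W\<^esub> ba \<otimes>\<^bsub>W\<^esub> cb [^]\<^bsub>W\<^esub> (2::nat)"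
  define y where "y l = bc [^]\<^bsub>W\<^esub> (4 * l) \<otimes>\<^bsub>W\<^esub> z \<otimes>\<^bsub>W\<^esub> cb [^]\<^bsub>W\<^esub> (4 * l)" for l :: nat
  have zcl [simp]: "z \<in> carrier W" by (simp add: z_def)
  have ycl [simp]: "y l \<in> carrier W" for l by (simp add: y_def)
  have Qy: "?Q (y l)" for l
    unfolding y_def z_def by (intro Q_mult Q_pow Q W.m_closed W.nat_pow_closed cl)
  have \<phi>z: "\<phi> z = flip (delta 0 + delta 2)"
  proof -
    have "\<phi> z = a \<circ> b \<circ> lift (mod_rot n (-2)) \<circ> (b \<circ> a) \<circ> lift (mod_rot n (-2))"
      by (simp add: z_def \<phi>.hom_nat_pow K_simps K_pow \<phi>edge lift_pow mod_rot_pow)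
    also have "\<dots> = a \<circ> (b \<circ> lift (mod_rot n (-2)) \<circ> b) \<circ> a \<circ> lift (mod_rot n (-2))"
      by (simp only: o_assoc)
    also have "b \<circ> lift (mod_rot n (-2)) \<circ> b = lift (mod_rot n 2)"
      by (simp add: b_def lift_lift mod_refl_rot mod_refl_refl)
    also have "a \<circ> lift (mod_rot n 2) \<circ> a = flip (delta 0 + delta 2) \<circ> lift (mod_rot n 2)"
      using lift_mod_rot_flip_delta[of 0 n 2] n4
      by (simp add: a_def o_assoc[symmetric] flip_flip[symmetric])
    also have "\<dots> \<circ> lift (mod_rot n (-2)) = flip (delta 0 + delta 2)"
      by (simp add: o_assoc[symmetric] lift_lift mod_rot_rot mod_rot_id lift_id)
    finally show ?thesis .
  qed
  have \<phi>y: "\<phi> (y l) = flip (delta (4 * int l) + delta (4 * int l + 2))" if "l < N" for l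
  proof -
    let ?R = "lift (mod_rot n (4 * int l))" and ?R' = "lift (mod_rot n (- 4 * int l))"
    have "\<phi> (y l) = ?R \<circ> (flip (delta 0) \<circ> flip (delta 2)) \<circ> ?R'"
      by (simp add: y_def \<phi>.hom_nat_pow K_simps K_pow \<phi>edge \<phi>z lift_pow mod_rot_pow flip_flip)
    also have "\<dots> = ((?R \<circ> flip (delta 0)) \<circ> flip (delta 2)) \<circ> ?R'" by (simp only: o_assoc)
    also have "?R \<circ> flip (delta 0) = flip (delta (4 * int l)) \<circ> ?R"
      using lift_mod_rot_flip_delta[of 0 n "4 * int l"] n that by simp
    also have "flip (delta (4 * int l)) \<circ> ?R \<circ> flip (delta 2)
        = flip (delta (4 * int l)) \<circ> (?R \<circ> flip (delta 2))" by (simp only: o_assoc)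
    also have "?R \<circ> flip (delta 2) = flip (delta (4 * int l + 2)) \<circ> ?R"
      using lift_mod_rot_flip_delta[of 2 n "4 * int l"] n that by (simp add: add.commute)
    also have "flip (delta (4 * int l)) \<circ> (flip (delta (4 * int l + 2)) \<circ> ?R) \<circ> ?R'
        = flip (delta (4 * int l)) \<circ> flip (delta (4 * int l + 2)) \<circ> (?R \<circ> ?R')"
      by (simp only: o_assoc)
    also have "?R \<circ> ?R' = id" by (simp add: lift_lift mod_rot_rot mod_rot_id lift_id)
    finally show ?thesis by (simp add: flip_flip)
  qed
  have ab_ba: "?\<rho> ab * ?\<rho> ba = 1\<^sub>m r"
  proof -
    have "ab \<otimes>\<^bsub>W\<^esub> ba = w i \<otimes>\<^bsub>W\<^esub> (w j \<otimes>\<^bsub>W\<^esub> w j) \<otimes>\<^bsub>W\<^esub> w i"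
      using w by (simp add: defs W.m_assoc)
    also have "\<dots> = \<one>\<^bsub>W\<^esub>" using w wsq by simp
    finally show ?thesis using mult[of ab ba] int_rep_one[OF sys] by simp
  qed
  have bc4: "cong_mat r 4 (?\<rho> (bc [^]\<^bsub>W\<^esub> l)) (1\<^sub>m r)" if "even l" for l :: nat
    unfolding bc_def using that
    by (intro cong_mat_dvd[OF int_rep_infinite_edge_pow[OF sys ijk(2,3,5)]]) auto
  have cb4: "cong_mat r 4 (?\<rho> (cb [^]\<^bsub>W\<^esub> l)) (1\<^sub>m r)" if "even l" for l :: nat
    unfolding cb_def using that
    by (intro cong_mat_dvd[OF int_rep_infinite_edge_pow[OF sys ijk(3,2) mkj]]) auto
  have z4: "cong_mat r 4 (?\<rho> z) (1\<^sub>m r)"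
  proof -
    have "cong_mat r 4 (?\<rho> z) (?\<rho> ab * 1\<^sub>m r * ?\<rho> ba * 1\<^sub>m r)"
      unfolding z_def
      by (simp only: mult cl W.m_closed W.nat_pow_closed)
        (intro cong_mat_mult mult_carrier_mat[of _ r r _ r] car cl W.nat_pow_closed one_carrier_mat
          cong_mat_refl cb4 even_numeral)
    then show ?thesis
      using right_mult_one_mat[OF car[of ab]] ab_ba by simp
  qed
  have y4: "cong_mat r 4 (?\<rho> (y l)) (1\<^sub>m r)" for l
  proof -
    have "cong_mat r 4 (?\<rho> (y l)) (1\<^sub>m r * 1\<^sub>m r * 1\<^sub>m r)"
      unfolding y_def
      by (simp only: mult cl zcl W.m_closed W.nat_pow_closed)
        (intro cong_mat_mult mult_carrier_mat[of _ r r _ r] car cl zcl W.nat_pow_closed one_carrier_mat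
          bc4 cb4 z4, simp_all)
    then show ?thesis by simp
  qed

  define \<Gamma> where "\<Gamma> = {(?\<rho> g, v) | g v. g \<in> carrier W \<and> ?Q g \<and> \<phi> g = flip v \<and>
    cong_mat r 4 (?\<rho> g) (1\<^sub>m r)}"
  interpret two_adic_pairs r \<Gamma>
  proof
    show "(A * B, v + u) \<in> \<Gamma>" if AB: "(A, v) \<in> \<Gamma>" "(B, u) \<in> \<Gamma>" for A B v u
    proof -
      obtain g h where g: "g \<in> carrier W" "?Q g" "\<phi> g = flip v" "cong_mat r 4 (?\<rho> g) (1\<^sub>m r)" "A = ?\<rho> g"
        and h: "h \<in> carrier W" "?Q h" "\<phi> h = flip u" "cong_mat r 4 (?\<rho> h) (1\<^sub>m r)" "B = ?\<rho> h"
        using AB by (auto simp: \<Gamma>_def)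
      have "cong_mat r 4 (A * B) (1\<^sub>m r * 1\<^sub>m r)"
        unfolding g h by (intro cong_mat_mult car g h one_carrier_mat)
      moreover have "\<phi> (g \<otimes>\<^bsub>W\<^esub> h) = flip (v + u)" using g h by (simp add: K_simps flip_flip)
      moreover have "A * B = ?\<rho> (g \<otimes>\<^bsub>W\<^esub> h)" using g h mult by simp
      ultimately show ?thesis
        unfolding \<Gamma>_def using g h Q_mult by (intro CollectI exI[of _ "g \<otimes>\<^bsub>W\<^esub> h"] exI[of _ "v + u"]) simp
    qed
  qed (auto simp: \<Gamma>_def bit_fun_add_self intro: car)
  have "\<exists>A v. (A, v) \<in> \<Gamma> \<and> v \<noteq> 0 \<and> cong_mat r (2 ^ e) A (1\<^sub>m r)"
  proof (rule exists_deep_pair)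
    show "r * r < N" by (simp add: N_def)
    show "(?\<rho> (y l), delta (4 * int l) + delta (4 * int l + 2)) \<in> \<Gamma>" if "l < N" for l
      unfolding \<Gamma>_def using ycl[of l] Qy[of l] \<phi>y[OF that] y4[of l] by blast
    show "(\<Sum>l\<in>T. delta (4 * int l) + delta (4 * int l + 2)) \<noteq> 0" if "T \<subseteq> {..<N}" "T \<noteq> {}" for T
      using that finite_subset by (intro delta_pairs_independent) auto
  qed
  then obtain g v where g: "g \<in> carrier W" "?Q g" "\<phi> g = flip v" "v \<noteq> 0"
    "cong_mat r (2 ^ e) (?\<rho> g) (1\<^sub>m r)" by (auto simp: \<Gamma>_def)
  then obtain h where h: "h \<in> carrier W" "\<phi> h = flip v" "cong_mat r (int k1) (?\<rho> h) (1\<^sub>m r)"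
    "cong_mat r (2 ^ e) (?\<rho> h) (1\<^sub>m r)"
    unfolding odd_twist_def by (auto intro: cong_mat_trans)
  have "cong_mat r (int k0) (?\<rho> h) (1\<^sub>m r)"
  proof -
    have "coprime (2 ^ e :: int) (int k1)" using k1(2) by simp
    moreover have "int k0 = 2 ^ e * int k1" using arg_cong[OF k1(1), of int] by (simp add: e_def)
    ultimately show ?thesis
      using cong_mat_coprime[OF _ h(4,3)] by simp
  qed
  then have "h \<in> kernel W K \<phi>"
    using principal_congruence_subgroupI[OF sys h(1)] sub by blast
  then show False using h(2) g(4) by (simp add: kernel_def K_simps flip_eq_id)
qed

theorem proposition3p10:
  shows "(\<forall>(W :: ('a, 'b) monoid_scheme) (r :: nat) (w :: nat \<Rightarrow> 'a) (m :: nat \<Rightarrow> nat \<Rightarrow> enat).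
            right_angled_coxeter_system W r w m \<and> infinite (carrier W) \<and>
            irreducible_system W (w ` {..<r}) \<and> r > 2 \<longrightarrow>
            \<not> has_congruence_subgroup_property W r w m) \<and>
         (\<forall>n\<ge>4. \<not> has_congruence_subgroup_property (twin_group n) (n - 1) (twin_gen n) twin_matrix)"
proof (intro conjI allI impI)
  fix W :: "('a, 'b) monoid_scheme" and r :: nat and w :: "nat \<Rightarrow> 'a" and m :: "nat \<Rightarrow> nat \<Rightarrow> enat"
  assume "right_angled_coxeter_system W r w m \<and> infinite (carrier W) \<and>
    irreducible_system W (w ` {..<r}) \<and> r > 2"
  then show "\<not> has_congruence_subgroup_property W r w m"
    by (metis irreducible_system_path path_not_congruence_subgroup_property)
next
  fix n :: nat assume "n \<ge> 4"
  then show "\<not> has_congruence_subgroup_property (twin_group n) (n - 1) (twin_gen n) twin_matrix"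
    by (intro path_not_congruence_subgroup_property[OF twin_group_coxeter_system, of 0 n 1 2])
      (auto simp: twin_matrix_def)
qed

end
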